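(* Let $\gamma,\tau>0$ and consider the Stochastic PDDY algorithm: given $p^0\in\mathcal{X}$, $y^0\in\mathcal{Y}$, for $k=0,1,2,\dots$ $$\begin{aligned} y^{k+1}&=\mathrm{prox}_{\tau H^*}\big(y^k+\tau L(p^k-\gamma L^*y^k)\big),\\ x^k&=p^k-\gamma L^*y^{k+1},\\ s^{k+1}&=\mathrm{prox}_{\gamma R}\big(2x^k-p^k-\gamma g^{k+1}\big),\\ p^{k+1}&=p^k+s^{k+1}-x^k,\end{aligned}$$ where $(g^k)$ satisfies the Stochastic Gradient Assumption (see context) with constants $\alpha,\beta,\delta\ge0$, $\rho\in(0,1]$ and process $(\sigma_k)$. Suppose that $H$ is $1/\mu_{H^*}$-smooth and $R$ is $\mu_R$-strongly convex, for some $\mu_R>0$ and $\mu_{H^*}>0$. Suppose that $\gamma\le\frac{1}{\alpha+\kappa\delta}$ for some $\kappa>\beta/\rho$, that $\gamma\tau\|L\|^2<1$, and that $\gamma^2\le\frac{\mu_{H^*}}{\|L\|^2\mu_R}$. Define $\eta:=2(\mu_{H^*}-\gamma^2\|L\|^2\mu_R)\ge0$ and, for every $k\in\mathbb{N}$, $$V^k:=(1+\gamma\mu_R)\|p^k-p^\star\|^2+(1+\tau\eta)\|y^k-y^\star\|_{\gamma,\tau}^2+\kappa\gamma^2\sigma_k^2,$$ $$r:=\max\Big(\frac{1}{1+\gamma\mu_R},\ 1-\rho+\frac{\beta}{\kappa},\ \frac{1}{1+\tau\eta}\Big).$$ Then, for every $k\in\mathbb{N}$, $\mathbb{E}V^k\le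 r^kV^0$.
   Context: $\mathcal{X},\mathcal{Y}$ are finite-dimensional real Hilbert spaces, $L:\mathcal{X}\to\mathcal{Y}$ is a linear operator with adjoint $L^*$ and operator norm $\|L\|$. $F:\mathcal{X}\to\mathbb{R}$ is convex and $\nu$-smooth for some $\nu>0$. A function is $c$-smooth if it is (real-valued and) differentiable everywhere with $c$-Lipschitz gradient. $R:\mathcal{X}\to\mathbb{R}\cup\{+\infty\}$ and $H:\mathcal{Y}\to\mathbb{R}\cup\{+\infty\}$ are proper, convex, lower semicontinuous. $G^*$ is the convex conjugate and $\mathrm{prox}_G(z)=\arg\min_{z'}\{G(z')+\tfrac12\|z-z'\|^2\}$. Standing assumption: there exists $(x^\star,y^\star)\in\mathcal{X}\times\mathcal{Y}$ with $0\in\nabla F(x^\star)+\partial R(x^\star)+L^*y^\star$ and $Lx^\star\in\partial H^*(y^\star)$; such a pair is fixed, and $p^\star=x^\star+\gamma L^*y^\star$ (so that $(p^\star,y^\star)$ is the fixed point of the iteration associated with $(x^\star,y^\star)$). $\|\cdot\|_{\gamma,\tau}$ is the norm on $\mathcal{Y}$ given by $\|y\|_{\gamma,\tau}^2=\frac{\gamma}{\tau}\|y\|^2-\gamma^2\|L^*y\|^2$. Bregman divergence: $D_F(x,x')=F(x)-F(x')-\langle\nabla F(x'),x-x'\rangle$. Stochastic Gradient Assumption: on a filtered probability space $(\Omega,\mathscr{F},(\mathscr{F}_k)_{k\in\mathbb{N}},\mathbb{P})$, with $\mathbb{E}_k$ the conditional expectation given $\mathscr{F}_k$, $(g^k)$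 is an $(\mathscr{F}_k)$-adapted $\mathcal{X}$-valued process and there exist $\alpha,\beta,\delta\ge0$, $\rho\in(0,1]$ and a real $(\mathscr{F}_k)$-adapted process $(\sigma_k)_{k\in\mathbb{N}}$ such that for every $k\in\mathbb{N}$: $\mathbb{E}_k(g^{k+1})=\nabla F(x^k)$; $\mathbb{E}_k\|g^{k+1}-\nabla F(x^\star)\|^2\le2\alpha D_F(x^k,x^\star)+\beta\sigma_k^2$; $\mathbb{E}_k(\sigma_{k+1}^2)\le(1-\rho)\sigma_k^2+2\delta D_F(x^k,x^\star)$, where $x^k$ are the iterates of the algorithm. The initial data $p^0,y^0,\sigma_0$ are deterministic. *)

theory Defs
  imports "HOL-Probability.Probability"
begin

section \<open>Convex analysis for extended real-valued functions\<close>

definition proper_fun :: "('a \<Rightarrow> ereal) \<Rightarrow> bool" where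
  "proper_fun f \<longleftrightarrow> (\<forall>x. f x \<noteq> -\<infinity>) \<and> (\<exists>x. f x \<noteq> \<infinity>)"

definition convex_fun :: "('a::real_vector \<Rightarrow> ereal) \<Rightarrow> bool" where
  "convex_fun f \<longleftrightarrow>
     (\<forall>x y t. 0 \<le> t \<and> t \<le> 1 \<longrightarrow>
        f ((1 - t) *\<^sub>R x + t *\<^sub>R y) \<le> ereal (1 - t) * f x + ereal t * f y)"

definition lsc_fun :: "('a::topological_space \<Rightarrow> ereal) \<Rightarrow> bool" where
  "lsc_fun f \<longleftrightarrow> (\<forall>x. f x \<le> Liminf (at x) f)"

definition pcl_fun :: "('a::real_normed_vector \<Rightarrow> ereal) \<Rightarrow> bool" where
  "pcl_fun f \<longleftrightarrow> proper_fun f \<and> convex_fun f \<and> lsc_fun f"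

definition strongly_convex_fun :: "real \<Rightarrow> ('a::real_inner \<Rightarrow> ereal) \<Rightarrow> bool" where
  "strongly_convex_fun \<mu> f \<longleftrightarrow> convex_fun (\<lambda>x. f x - ereal (\<mu> / 2 * (norm x)\<^sup>2))"

text \<open>For a proper function the set below is empty outside the effective domain, as it should be.\<close>

definition subdifferential :: "('a::real_inner \<Rightarrow> ereal) \<Rightarrow> 'a \<Rightarrow> 'a set" where
  "subdifferential f x = {u. \<forall>z. f x + ereal (u \<bullet> (z - x)) \<le> f z}"

definition convex_conjugate :: "('a::real_inner \<Rightarrow> ereal) \<Rightarrow> 'a \<Rightarrow> ereal" where
  "convex_conjugate f u = (SUP x. ereal (x \<bullet> u) - f x)"

text \<open>For proper convex lower semicontinuous functions on a Euclidean space the minimizer exists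
  and is unique, so the choice operator behind \<open>arg_min\<close> is harmless there.\<close>

definition prox :: "('a::real_inner \<Rightarrow> ereal) \<Rightarrow> 'a \<Rightarrow> 'a" where
  "prox f z = (ARG_MIN (\<lambda>z'. f z' + ereal (1 / 2 * (norm (z - z'))\<^sup>2)) z'. True)"

section \<open>Smooth functions\<close>

definition gradient :: "('a::real_inner \<Rightarrow> real) \<Rightarrow> 'a \<Rightarrow> 'a" where
  "gradient f x = (THE D. GDERIV f x :> D)"

definition smooth_fun :: "real \<Rightarrow> ('a::real_inner \<Rightarrow> real) \<Rightarrow> bool" where
  "smooth_fun c f \<longleftrightarrow> (\<forall>x. f differentiable (at x)) \<and> c-lipschitz_on UNIV (gradient f)"

text \<open>An extended real-valued function counts as smooth only if it is finite everywhere.\<close>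

definition smooth_efun :: "real \<Rightarrow> ('a::real_inner \<Rightarrow> ereal) \<Rightarrow> bool" where
  "smooth_efun c f \<longleftrightarrow> (\<exists>h. f = (\<lambda>x. ereal (h x)) \<and> smooth_fun c h)"

definition bregman :: "('a::real_inner \<Rightarrow> real) \<Rightarrow> 'a \<Rightarrow> 'a \<Rightarrow> real" where
  "bregman f x x' = f x - f x' - gradient f x' \<bullet> (x - x')"

section \<open>Primal--dual solutions and the stochastic PDDY iteration\<close>

definition primal_dual_solution ::
    "('a::euclidean_space \<Rightarrow> real) \<Rightarrow> ('a \<Rightarrow> ereal) \<Rightarrow> ('b::euclidean_space \<Rightarrow> ereal) \<Rightarrow>
     ('a \<Rightarrow> 'b) \<Rightarrow> 'a \<Rightarrow> 'b \<Rightarrow> bool" where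
  "primal_dual_solution F R H L xs ys \<longleftrightarrow>
     0 \<in> {gradient F xs + u + adjoint L ys | u. u \<in> subdifferential R xs} \<and>
     L xs \<in> subdifferential (convex_conjugate H) ys"

definition dual_norm_sq ::
    "real \<Rightarrow> real \<Rightarrow> ('a::euclidean_space \<Rightarrow> 'b::euclidean_space) \<Rightarrow> 'b \<Rightarrow> real" where
  "dual_norm_sq \<gamma> \<tau> L y = \<gamma> / \<tau> * (norm y)\<^sup>2 - \<gamma>\<^sup>2 * (norm (adjoint L y))\<^sup>2"

text \<open>The recursion is stated for a single sample path.\<close>

definition pddy_path ::
    "real \<Rightarrow> real \<Rightarrow> ('a::euclidean_space \<Rightarrow> 'b::euclidean_space) \<Rightarrow> ('a \<Rightarrow> ereal) \<Rightarrow> ('b \<Rightarrow> ereal) \<Rightarrow>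
     'a \<Rightarrow> 'b \<Rightarrow> (nat \<Rightarrow> 'a) \<Rightarrow>
     (nat \<Rightarrow> 'a) \<Rightarrow> (nat \<Rightarrow> 'b) \<Rightarrow> (nat \<Rightarrow> 'a) \<Rightarrow> (nat \<Rightarrow> 'a) \<Rightarrow> bool" where
  "pddy_path \<gamma> \<tau> L R H p0 y0 g p y x s \<longleftrightarrow>
     p 0 = p0 \<and> y 0 = y0 \<and>
     (\<forall>k. y (Suc k) = prox (\<lambda>v. ereal \<tau> * convex_conjugate H v)
                         (y k + \<tau> *\<^sub>R L (p k - \<gamma> *\<^sub>R adjoint L (y k))) \<and>
          x k = p k - \<gamma> *\<^sub>R adjoint L (y (Suc k)) \<and>
          s (Suc k) = prox (\<lambda>v. ereal \<gamma> * R v) (2 *\<^sub>R x k - p k - \<gamma> *\<^sub>R g (Suc k)) \<and>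
          p (Suc k) = p k + s (Suc k) - x k)"

section \<open>The stochastic gradient assumption\<close>

text \<open>\<open>has_cond_exp M G f h\<close> says that \<open>h\<close> is a version of the conditional expectation of the
  integrable vector-valued function \<open>f\<close> given the sub-sigma-algebra \<open>G\<close>; the library's
  \<open>real_cond_exp\<close> covers real-valued functions only.\<close>

definition has_cond_exp ::
    "'w measure \<Rightarrow> 'w measure \<Rightarrow> ('w \<Rightarrow> 'a::euclidean_space) \<Rightarrow> ('w \<Rightarrow> 'a) \<Rightarrow> bool" where
  "has_cond_exp M G f h \<longleftrightarrow>
     integrable M f \<and> integrable M h \<and> h \<in> borel_measurable G \<and>
     (\<forall>A\<in>sets G. set_lebesgue_integral M A f = set_lebesgue_integral M A h)"

definition filtered_prob_space :: "'w measure \<Rightarrow> (nat \<Rightarrow> 'w measure) \<Rightarrow> bool" where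
  "filtered_prob_space M \<F> \<longleftrightarrow>
     prob_space M \<and> filtration (space M) \<F> \<and> (\<forall>k. subalgebra M (\<F> k))"

text \<open>Conditional expectations of squares are taken with the nonnegative version \<open>nn_cond_exp\<close>,
  so that no second moment has to be finite beforehand. The real numbers wrapped in \<open>ennreal\<close> on
  the right-hand sides are nonnegative when \<open>F\<close> is convex and differentiable, \<open>\<rho> \<le> 1\<close>, and
  the constants are nonnegative.\<close>

definition stochastic_gradient_assumption ::
    "'w measure \<Rightarrow> (nat \<Rightarrow> 'w measure) \<Rightarrow> ('a::euclidean_space \<Rightarrow> real) \<Rightarrow> 'a \<Rightarrow>
     real \<Rightarrow> real \<Rightarrow> real \<Rightarrow> real \<Rightarrow>
     (nat \<Rightarrow> 'w \<Rightarrow> 'a) \<Rightarrow> (nat \<Rightarrow> 'w \<Rightarrow> 'a) \<Rightarrow> (nat \<Rightarrow> 'w \<Rightarrow> real) \<Rightarrow> bool" where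
  "stochastic_gradient_assumption M \<F> F xs \<alpha> \<beta> \<delta> \<rho> x g \<sigma> \<longleftrightarrow>
     0 \<le> \<alpha> \<and> 0 \<le> \<beta> \<and> 0 \<le> \<delta> \<and> 0 < \<rho> \<and> \<rho> \<le> 1 \<and>
     (\<forall>k. g k \<in> borel_measurable (\<F> k)) \<and>
     (\<forall>k. \<sigma> k \<in> borel_measurable (\<F> k)) \<and>
     (\<forall>k. has_cond_exp M (\<F> k) (g (Suc k)) (\<lambda>\<omega>. gradient F (x k \<omega>))) \<and>
     (\<forall>k. AE \<omega> in M.
        nn_cond_exp M (\<F> k) (\<lambda>\<omega>. ennreal ((norm (g (Suc k) \<omega> - gradient F xs))\<^sup>2)) \<omega>
          \<le> ennreal (2 * \<alpha> * bregman F (x k \<omega>) xs + \<beta> * (\<sigma> k \<omega>)\<^sup>2)) \<and>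
     (\<forall>k. AE \<omega> in M.
        nn_cond_exp M (\<F> k) (\<lambda>\<omega>. ennreal ((\<sigma> (Suc k) \<omega>)\<^sup>2)) \<omega>
          \<le> ennreal ((1 - \<rho>) * (\<sigma> k \<omega>)\<^sup>2 + 2 * \<delta> * bregman F (x k \<omega>) xs))"

end

theory Submission
  imports Defs
begin

text \<open>
  Strong monotonicity of the subdifferentials of \<open>R\<close> and of the conjugate of \<open>H\<close> (the latter by the
  Baillon--Haddad inequality for the smooth function \<open>H\<close>), applied to the two proximal steps, bounds
  the distance of the next iterate to the fixed point by that of the current one plus the terms
  \<open>- 2 \<gamma> \<langle>g - \<nabla>F(x\<^sup>\<star>), x - x\<^sup>\<star>\<rangle> + \<gamma>\<^sup>2 \<parallel>g - \<nabla>F(x\<^sup>\<star>)\<parallel>\<^sup>2\<close>, with a gain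
  \<open>2 \<gamma> \<mu>R \<parallel>s - x\<^sup>\<star>\<parallel>\<^sup>2 + 2 \<gamma> \<mu>H \<parallel>y - y\<^sup>\<star>\<parallel>\<^sup>2\<close>. Since the difference between \<open>p - p\<^sup>\<star>\<close> and
  \<open>s - x\<^sup>\<star>\<close> is \<open>\<gamma>\<close> times the adjoint of \<open>L\<close> at \<open>y - y\<^sup>\<star>\<close>, part of the dual gain turns the primal gain into
  one in \<open>\<parallel>p - p\<^sup>\<star>\<parallel>\<^sup>2\<close>; what remains has the factor \<open>\<eta>\<close>. In expectation the gradient
  terms leave a multiple of the Bregman divergence with factor
  \<open>- 2 \<gamma> (1 - \<gamma> (\<alpha> + \<kappa> \<delta>)) \<le> 0\<close> once \<open>\<kappa> \<gamma>\<^sup>2 \<sigma>\<^sup>2\<close> is added to the Lyapunov function.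
\<close>

section \<open>Subdifferentials and the proximal operator\<close>

text \<open>Divide by \<open>s\<close> and let \<open>s\<close> decrease to 0. This extracts a
  first-order condition from an inequality along a segment, with \<open>B\<close> collecting the
  quadratic remainder.\<close>

lemma linear_term_nonneg:
  fixes A B :: real
  assumes "\<And>s. 0 < s \<Longrightarrow> s \<le> 1 \<Longrightarrow> 0 \<le> s * A + s\<^sup>2 * B"
  shows "0 \<le> A"
proof (rule tendsto_lowerbound)
  show "((\<lambda>s. A + s * B) \<longlongrightarrow> A) (at_right 0)"
    by (auto intro!: tendsto_eq_intros)
  have "eventually (\<lambda>s::real. 0 < s \<and> s < 1) (at_right 0)"
    by (auto simp: eventually_at_right_field intro: exI[of _ 1])
  then show "\<forall>\<^sub>F s in at_right 0. 0 \<le> A + s * B"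
  proof (rule eventually_mono)
    fix s :: real
    assume s: "0 < s \<and> s < 1"
    then have "0 \<le> s * (A + s * B)"
      using assms[of s] by (simp add: algebra_simps power2_eq_square)
    then show "0 \<le> A + s * B"
      using s by (simp add: zero_le_mult_iff)
  qed
qed simp

text \<open>A closed epigraph is the form in which lower semicontinuity enters the existence of
  proximal points. If a limit of epigraph points lay strictly below the graph, a level
  \<open>c\<close> in between would be exceeded by \<open>f\<close> near \<open>v\<close>, hence
  eventually by the heights \<open>snd (X n)\<close>.\<close>

lemma closed_epigraph_lsc:
  fixes f :: "'a::euclidean_space \<Rightarrow> ereal"
  assumes "lsc_fun f"
  shows "closed {(v, t). f v \<le> ereal t}"
  unfolding closed_sequential_limits
proof safe
  fix X :: "nat \<Rightarrow> 'a \<times> real" and v t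
  assume X: "\<forall>n. X n \<in> {(v, t). f v \<le> ereal t}" and lim: "X \<longlonglongrightarrow> (v, t)"
  have lim1: "(\<lambda>n. fst (X n)) \<longlonglongrightarrow> v" and lim2: "(\<lambda>n. snd (X n)) \<longlonglongrightarrow> t"
    using tendsto_fst[OF lim] tendsto_snd[OF lim] by simp_all
  show "f v \<le> ereal t"
  proof (rule ccontr)
    assume "\<not> f v \<le> ereal t"
    then obtain c where c: "ereal t < ereal c" "ereal c < f v"
      using ereal_dense2[of "ereal t" "f v"] by (auto simp: not_le)
    have "f v \<le> Liminf (at v) f"
      using assms by (simp add: lsc_fun_def)
    then have "eventually (\<lambda>w. ereal c < f w) (at v)"
      using c by (simp add: le_Liminf_iff)
    \<comment> \<open>\<open>Liminf (at v)\<close> ignores the point \<open>v\<close> itself, which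
      the sequence may hit; the bound \<open>c < f v\<close> fills that gap.\<close>
    then have "eventually (\<lambda>w. ereal c < f w) (nhds v)"
      using c by (auto simp: eventually_at_filter elim: eventually_mono)
    then have "eventually (\<lambda>n. ereal c < f (fst (X n))) sequentially"
      using lim1 by (rule eventually_compose_filterlim)
    then have "eventually (\<lambda>n. c \<le> snd (X n)) sequentially"
    proof (rule eventually_mono)
      fix n assume "ereal c < f (fst (X n))"
      moreover have "f (fst (X n)) \<le> ereal (snd (X n))"
        using X[rule_format, of n] by (auto simp: case_prod_unfold)
      ultimately have "ereal c < ereal (snd (X n))"
        by (rule less_le_trans)
      then show "c \<le> snd (X n)"
        by simp
    qed
    then have "c \<le> t"
      using lim2 tendsto_lowerbound by (metis trivial_limit_sequentially)
    then show False
      using c by simp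
  qed
qed

text \<open>The epigraph of a supremum is the intersection of the epigraphs: a closed half-space for
  each \<open>x\<close> with \<open>f x\<close> finite, and everything or nothing for the other
  \<open>x\<close>.\<close>

lemma closed_epigraph_conjugate:
  fixes f :: "'a::euclidean_space \<Rightarrow> ereal"
  shows "closed {(u, t). convex_conjugate f u \<le> ereal t}"
proof -
  have "{(u, t). convex_conjugate f u \<le> ereal t}
      = (\<Inter>x. {(u, t). ereal (x \<bullet> u) - f x \<le> ereal t})"
    by (auto simp: convex_conjugate_def SUP_le_iff)
  moreover have "closed {(u::'a, t). ereal (x \<bullet> u) - f x \<le> ereal t}" for x
  proof (cases "f x")
    case (real b)
    have "closed {z::'a \<times> real. x \<bullet> fst z - b \<le> snd z}"
      by (intro closed_Collect_le continuous_intros)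
    moreover have "{(u::'a, t). ereal (x \<bullet> u) - f x \<le> ereal t}
        = {z::'a \<times> real. x \<bullet> fst z - b \<le> snd z}"
      using real by auto
    ultimately show ?thesis
      by simp
  qed auto
  ultimately show ?thesis
    by auto
qed

section \<open>The Fenchel--Young inequality and convexity of the conjugate\<close>

lemma convex_conjugate_upper:
  "ereal (x \<bullet> u - h x) \<le> convex_conjugate (\<lambda>x. ereal (h x)) u"
  unfolding convex_conjugate_def by (rule SUP_upper2[of x]) auto

lemma convex_conjugate_convex:
  fixes h :: "'a::euclidean_space \<Rightarrow> real"
  shows "convex_fun (convex_conjugate (\<lambda>x. ereal (h x)))"
  unfolding convex_fun_def
proof safe
  fix u v :: 'a and t :: real
  assume t: "0 \<le> t" "t \<le> 1"
  let ?H = "convex_conjugate (\<lambda>x. ereal (h x))"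
  show "?H ((1 - t) *\<^sub>R u + t *\<^sub>R v) \<le> ereal (1 - t) * ?H u + ereal t * ?H v"
    \<comment> \<open>Only the conjugate on the left is unfolded: each affine function in its
      supremum splits into parts at \<open>u\<close> and \<open>v\<close>, and Fenchel--Young bounds
      each part.\<close>
    unfolding convex_conjugate_def[of _ "(1 - t) *\<^sub>R u + t *\<^sub>R v"]
  proof (rule SUP_least)
    fix x
    have "ereal (x \<bullet> ((1 - t) *\<^sub>R u + t *\<^sub>R v)) - ereal (h x)
        = ereal (1 - t) * ereal (x \<bullet> u - h x) + ereal t * ereal (x \<bullet> v - h x)"
      by (simp add: algebra_simps)
    also have "\<dots> \<le> ereal (1 - t) * ?H u + ereal t * ?H v"
      by (intro add_mono ereal_mult_left_mono convex_conjugate_upper) (use t in auto)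
    finally show "ereal (x \<bullet> ((1 - t) *\<^sub>R u + t *\<^sub>R v)) - ereal (h x)
        \<le> ereal (1 - t) * ?H u + ereal t * ?H v" .
  qed
qed

section \<open>Finiteness and monotonicity at points with subgradients\<close>

lemma subdifferential_finite:
  assumes "proper_fun f" "u \<in> subdifferential f a"
  obtains b where "f a = ereal b"
proof (cases "f a")
  \<comment> \<open>A subgradient at a point of infinite value would make \<open>f\<close> infinite
    everywhere, against properness.\<close>
  case PInf
  then have "f z = \<infinity>" for z
    using assms(2) unfolding subdifferential_def mem_Collect_eq
    by (metis ereal_plus_eq_PInfty ereal_infty_less_eq(1))
  then show ?thesis
    using assms(1) by (auto simp: proper_fun_def)
qed (use assms in \<open>auto simp: proper_fun_def\<close>)

lemma subdifferentialD:
  assumes "u \<in> subdifferential f a" "f a = ereal b" "f v = ereal t"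
  shows "b + u \<bullet> (v - a) \<le> t"
proof -
  have "f a + ereal (u \<bullet> (v - a)) \<le> f v"
    using assms(1) by (simp add: subdifferential_def)
  then show ?thesis
    using assms by simp
qed

lemma subdifferential_monotone:
  assumes "proper_fun f" "u \<in> subdifferential f a" "v \<in> subdifferential f b"
  shows "0 \<le> (u - v) \<bullet> (a - b)"
proof -
  obtain c where c: "f a = ereal c"
    using subdifferential_finite assms by blast
  obtain d where d: "f b = ereal d"
    using subdifferential_finite assms by blast
  show ?thesis
    using subdifferentialD[OF assms(2) c d] subdifferentialD[OF assms(3) d c]
    by (simp add: algebra_simps)
qed

text \<open>The proximal objective is minimized as the continuous function
  \<open>(v, t) \<mapsto> c t + \<parallel>z - v\<parallel>\<^sup>2 / 2\<close> over the closed epigraph; the affine minorant makes the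
  relevant part of the epigraph bounded.\<close>

lemma prox_exists:
  fixes f :: "'a::euclidean_space \<Rightarrow> ereal"
  assumes closed: "closed {(v, t). f v \<le> ereal t}" and proper: "proper_fun f"
    and u: "u \<in> subdifferential f a" and c: "0 < c"
  obtains b where "f (prox (\<lambda>v. ereal c * f v) z) = ereal b"
    and "\<And>v t. f v \<le> ereal t \<Longrightarrow>
      c * b + 1 / 2 * (norm (z - prox (\<lambda>v. ereal c * f v) z))\<^sup>2 \<le> c * t + 1 / 2 * (norm (z - v))\<^sup>2"
proof -
  obtain fa where fa: "f a = ereal fa"
    using subdifferential_finite[OF proper u] .
  have minor: "fa + u \<bullet> (v - a) \<le> t" if "f v \<le> ereal t" for v t
  proof -
    have "f a + ereal (u \<bullet> (v - a)) \<le> ereal t"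
      using u that by (auto simp: subdifferential_def intro: order_trans)
    then show ?thesis
      by (simp add: fa)
  qed
  let ?E = "{(v, t). f v \<le> ereal t}"
  define \<phi> where "\<phi> = (\<lambda>w. c * snd w + 1 / 2 * (norm (z - fst w))\<^sup>2)"
  \<comment> \<open>The objective at the known point \<open>(a, fa)\<close>; it makes the sublevel
    set \<open>S\<close> nonempty.\<close>
  define K where "K = \<phi> (a, fa)"
  define S where "S = ?E \<inter> {w. \<phi> w \<le> K}"
  have cont: "continuous_on A \<phi>" for A
    unfolding \<phi>_def by (intro continuous_intros)
  have "closed S"
    unfolding S_def using closed cont[of UNIV]
    by (intro closed_Int closed closed_Collect_le) (auto intro: continuous_intros)
  moreover have "bounded S"
  proof -
    \<comment> \<open>Completing the square: with \<open>t\<close> replaced by the affine minorant,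
      the objective is least at \<open>d\<close>, and membership in \<open>S\<close> becomes
      \<open>(norm (v - d))\<^sup>2 \<le> 2 * C\<close>.\<close>
    define d where "d = z - c *\<^sub>R u"
    define C where "C = K - c * (fa + u \<bullet> (z - a)) + c\<^sup>2 / 2 * (norm u)\<^sup>2"
    have v: "norm (v - d) \<le> sqrt (2 * C)" if "(v, t) \<in> S" for v t
    proof -
      have le: "c * (fa + u \<bullet> (v - a)) \<le> c * t"
        using that minor[of v t] c by (simp add: S_def)
      have "(norm (v - d))\<^sup>2 = (norm (z - v))\<^sup>2 + 2 * c * (u \<bullet> (v - z)) + c\<^sup>2 * (norm u)\<^sup>2"
        unfolding d_def power2_norm_eq_inner
        by (simp add: algebra_simps inner_commute power2_eq_square)
      moreover have "c * t + 1 / 2 * (norm (z - v))\<^sup>2 \<le> K"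
        using that by (simp add: S_def \<phi>_def)
      ultimately have "(norm (v - d))\<^sup>2 \<le> 2 * C"
        using le unfolding C_def by (simp add: algebra_simps)
      then show ?thesis
        by (simp add: real_le_rsqrt)
    qed
    \<comment> \<open>Heights are bounded below by the minorant over the ball, and above by
      \<open>K / c\<close> because the quadratic term is nonnegative.\<close>
    have "S \<subseteq> cball d (sqrt (2 * C))
        \<times> {fa + u \<bullet> (d - a) - norm u * sqrt (2 * C) .. K / c}"
    proof (safe)
      fix v t assume S: "(v, t) \<in> S"
      show "v \<in> cball d (sqrt (2 * C))"
        using v[OF S] by (simp add: dist_norm norm_minus_commute)
      have "- (u \<bullet> (v - d)) \<le> norm u * norm (v - d)"
        using norm_cauchy_schwarz[of "-u" "v - d"] by simp
      also have "\<dots> \<le> norm u * sqrt (2 * C)"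
        using v[OF S] by (intro mult_left_mono) auto
      finally have "- (u \<bullet> (v - d)) \<le> norm u * sqrt (2 * C)" .
      moreover have "fa + u \<bullet> (v - a) \<le> t"
        using S minor by (simp add: S_def)
      ultimately have "fa + u \<bullet> (d - a) - norm u * sqrt (2 * C) \<le> t"
        by (simp add: algebra_simps)
      moreover have "c * t \<le> K"
      proof -
        have "c * t + 1 / 2 * (norm (z - v))\<^sup>2 \<le> K"
          using S by (simp add: S_def \<phi>_def)
        then show ?thesis
          using zero_le_power2[of "norm (z - v)"] by linarith
      qed
      ultimately show "t \<in> {fa + u \<bullet> (d - a) - norm u * sqrt (2 * C) .. K / c}"
        using c by (simp add: field_simps)
    qed
    then show ?thesis
      by (rule bounded_subset[rotated]) (intro bounded_Times bounded_cball bounded_closed_interval)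
  qed
  ultimately have "compact S"
    by (simp add: compact_eq_bounded_closed)
  moreover have aS: "(a, fa) \<in> S"
    by (simp add: S_def K_def fa)
  ultimately obtain w where w: "w \<in> S" "\<And>w'. w' \<in> S \<Longrightarrow> \<phi> w \<le> \<phi> w'"
    using continuous_attains_inf[of S \<phi>] cont by blast
  obtain q t where qt: "w = (q, t)"
    by (cases w)
  \<comment> \<open>Points of the epigraph outside \<open>S\<close> have objective above
    \<open>K\<close>, so the minimum over \<open>S\<close> is one over the whole epigraph.\<close>
  have min: "\<phi> (q, t) \<le> \<phi> w'" if "w' \<in> ?E" for w'
  proof (cases "w' \<in> S")
    case False
    then have "K < \<phi> w'"
      using that by (auto simp: S_def)
    then show ?thesis
      using w(1) by (simp add: S_def qt)
  qed (use w qt in auto)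
  have fq_le: "f q \<le> ereal t"
    using w(1) by (simp add: S_def qt)
  have not_minf: "f v \<noteq> -\<infinity>" for v
    using proper by (simp add: proper_fun_def)
  obtain b where b: "f q = ereal b"
    using fq_le not_minf[of q] by (cases "f q") auto
  have qmin: "c * b + 1 / 2 * (norm (z - q))\<^sup>2 \<le> c * t' + 1 / 2 * (norm (z - v))\<^sup>2"
    if "f v \<le> ereal t'" for v t'
  proof -
    have "c * b \<le> c * t"
      using fq_le b c by simp
    then show ?thesis
      using min[of "(v, t')"] that by (simp add: \<phi>_def)
  qed
  define \<psi> where "\<psi> = (\<lambda>v. ereal c * f v + ereal (1 / 2 * (norm (z - v))\<^sup>2))"
  have "\<psi> q \<le> \<psi> v" for v
  proof (cases "f v")
    case (real t')
    then show ?thesis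
      using qmin[of v t'] by (simp add: \<psi>_def b)
  next
    case PInf
    then show ?thesis
      using c by (simp add: \<psi>_def)
  qed (use not_minf in simp)
  then have "is_arg_min \<psi> (\<lambda>_. True) q"
    by (simp add: is_arg_min_linorder)
  \<comment> \<open>\<open>prox\<close> is a choice among minimizers, and the existence of
    \<open>q\<close> guarantees that the chosen point is one. Comparing it with \<open>q\<close>
    then shows that \<open>f\<close> is finite there.\<close>
  then have "is_arg_min \<psi> (\<lambda>_. True) (prox (\<lambda>v. ereal c * f v) z)"
    unfolding prox_def arg_min_def \<psi>_def by (rule someI)
  then have "\<psi> (prox (\<lambda>v. ereal c * f v) z) \<le> \<psi> q"
    by (simp add: is_arg_min_linorder)
  then obtain b' where b': "f (prox (\<lambda>v. ereal c * f v) z) = ereal b'"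
    and "c * b' + 1 / 2 * (norm (z - prox (\<lambda>v. ereal c * f v) z))\<^sup>2 \<le> c * b + 1 / 2 * (norm (z - q))\<^sup>2"
    using not_minf[of "prox (\<lambda>v. ereal c * f v) z"] c
    by (cases "f (prox (\<lambda>v. ereal c * f v) z)") (auto simp: \<psi>_def b)
  then show thesis
    using that[OF b'] qmin by (meson order_trans)
qed

text \<open>The optimality condition of the proximal problem. Moving from the minimizer
  \<open>q\<close> by a fraction \<open>s\<close> towards \<open>v\<close> changes the objective by
  at most a linear term in \<open>s\<close> plus half of
  \<open>s\<^sup>2 * (norm (v - q))\<^sup>2\<close>; by \<open>linear_term_nonneg\<close> the linear
  coefficient is nonnegative.\<close>

lemma prox_subdifferential:
  fixes f :: "'a::euclidean_space \<Rightarrow> ereal"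
  assumes "closed {(v, t). f v \<le> ereal t}" and "proper_fun f" and conv: "convex_fun f"
    and "u \<in> subdifferential f a" and c: "0 < c"
  shows "(1 / c) *\<^sub>R (z - prox (\<lambda>v. ereal c * f v) z) \<in> subdifferential f (prox (\<lambda>v. ereal c * f v) z)"
proof -
  define q where "q = prox (\<lambda>v. ereal c * f v) z"
  obtain b where b: "f q = ereal b"
    and min: "\<And>v t. f v \<le> ereal t \<Longrightarrow>
      c * b + 1 / 2 * (norm (z - q))\<^sup>2 \<le> c * t + 1 / 2 * (norm (z - v))\<^sup>2"
    using prox_exists[OF assms(1,2,4,5), of z] unfolding q_def by blast
  have "f q + ereal ((1 / c) *\<^sub>R (z - q) \<bullet> (v - q)) \<le> f v" for v
  proof (cases "f v")
    case (real t)
    have "0 \<le> c * (t - b) - (z - q) \<bullet> (v - q)"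
    proof (rule linear_term_nonneg[of _ "1 / 2 * (norm (v - q))\<^sup>2"])
      fix s :: real
      assume s: "0 < s" "s \<le> 1"
      define w where "w = (1 - s) *\<^sub>R q + s *\<^sub>R v"
      have "f w \<le> ereal ((1 - s) * b + s * t)"
        using conv s b real unfolding convex_fun_def w_def
        by (metis less_imp_le plus_ereal.simps(1) times_ereal.simps(1))
      then have "c * b + 1 / 2 * (norm (z - q))\<^sup>2
          \<le> c * ((1 - s) * b + s * t) + 1 / 2 * (norm (z - w))\<^sup>2"
        by (rule min)
      moreover have "(norm (z - w))\<^sup>2
          = (norm (z - q))\<^sup>2 - 2 * s * ((z - q) \<bullet> (v - q)) + s\<^sup>2 * (norm (v - q))\<^sup>2"
      proof -
        have zw: "z - w = (z - q) - s *\<^sub>R (v - q)"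
          by (simp add: w_def algebra_simps)
        show ?thesis
          unfolding zw power2_norm_eq_inner
          by (simp add: inner_diff inner_commute power2_eq_square algebra_simps)
      qed
      ultimately show "0 \<le> s * (c * (t - b) - (z - q) \<bullet> (v - q))
          + s\<^sup>2 * (1 / 2 * (norm (v - q))\<^sup>2)"
        by (simp add: algebra_simps)
    qed
    then have "b + (z - q) \<bullet> (v - q) / c \<le> t"
      using c by (simp add: field_simps)
    then show ?thesis
      by (simp add: b real)
  next
    case MInf
    then show ?thesis
      using assms(2) by (simp add: proper_fun_def)
  qed simp
  then show ?thesis
    by (simp add: subdifferential_def q_def)
qed

text \<open>Monotonicity of the subdifferential gives firm nonexpansiveness, and Cauchy--Schwarz
  then the Lipschitz bound. The purpose is measurability of the iterates: the map, defined by
  choice, turns out to be continuous.\<close>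

lemma prox_nonexpansive:
  fixes f :: "'a::euclidean_space \<Rightarrow> ereal"
  assumes "closed {(v, t). f v \<le> ereal t}" and proper: "proper_fun f" and "convex_fun f"
    and "u \<in> subdifferential f a" and c: "0 < c"
  shows "norm (prox (\<lambda>v. ereal c * f v) z - prox (\<lambda>v. ereal c * f v) z') \<le> norm (z - z')"
proof -
  let ?q = "prox (\<lambda>v. ereal c * f v) z" and ?q' = "prox (\<lambda>v. ereal c * f v) z'"
  have "0 \<le> ((1 / c) *\<^sub>R (z - ?q) - (1 / c) *\<^sub>R (z' - ?q')) \<bullet> (?q - ?q')"
    by (rule subdifferential_monotone[OF proper]) (rule prox_subdifferential[OF assms])+
  also have "\<dots> = (1 / c) * ((z - z') \<bullet> (?q - ?q') - (norm (?q - ?q'))\<^sup>2)"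
    by (simp add: power2_norm_eq_inner algebra_simps)
  finally have "(norm (?q - ?q'))\<^sup>2 \<le> (z - z') \<bullet> (?q - ?q')"
    using c by (simp add: zero_le_mult_iff zero_le_divide_iff)
  also have "\<dots> \<le> norm (z - z') * norm (?q - ?q')"
    by (rule norm_cauchy_schwarz)
  finally have "norm (?q - ?q') * norm (?q - ?q') \<le> norm (z - z') * norm (?q - ?q')"
    by (simp add: power2_eq_square)
  then show ?thesis
    by (cases "?q = ?q'") (auto simp: mult_le_cancel_right)
qed

lemma prox_measurable:
  fixes f :: "'a::euclidean_space \<Rightarrow> ereal"
  assumes "closed {(v, t). f v \<le> ereal t}" "proper_fun f" "convex_fun f"
    and "u \<in> subdifferential f a" "0 < c"
  shows "prox (\<lambda>v. ereal c * f v) \<in> borel_measurable borel"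
proof -
  have "1-lipschitz_on UNIV (prox (\<lambda>v. ereal c * f v))"
    by (rule lipschitz_onI) (use prox_nonexpansive[OF assms] in \<open>simp_all add: dist_norm\<close>)
  then show ?thesis
    by (intro borel_measurable_continuous_onI lipschitz_on_continuous_on)
qed

text \<open>On the segment from \<open>a\<close> to \<open>v\<close>, convexity of \<open>f\<close>
  minus its quadratic bounds \<open>f w\<close> from above and the subgradient bounds it from below.
  The expansion of the squared norm of \<open>w\<close> has the defect
  \<open>s * (1 - s) * (norm (v - a))\<^sup>2\<close>, whose part linear in \<open>s\<close> is the
  extra quadratic term.\<close>

lemma strongly_convex_subgradient:
  fixes f :: "'a::real_inner \<Rightarrow> ereal"
  assumes conv: "strongly_convex_fun \<mu> f" and u: "u \<in> subdifferential f a"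
    and fa: "f a = ereal b" and fv: "f v = ereal t"
  shows "b + u \<bullet> (v - a) + \<mu> / 2 * (norm (v - a))\<^sup>2 \<le> t"
proof -
  have "0 \<le> t - b - u \<bullet> (v - a) - \<mu> / 2 * (norm (v - a))\<^sup>2"
  proof (rule linear_term_nonneg[of _ "\<mu> / 2 * (norm (v - a))\<^sup>2"])
    fix s :: real
    assume s: "0 < s" "s \<le> 1"
    define w where "w = (1 - s) *\<^sub>R a + s *\<^sub>R v"
    have "f w - ereal (\<mu> / 2 * (norm w)\<^sup>2)
        \<le> ereal (1 - s) * (f a - ereal (\<mu> / 2 * (norm a)\<^sup>2)) + ereal s * (f v - ereal (\<mu> / 2 * (norm v)\<^sup>2))"
      using conv s unfolding strongly_convex_fun_def convex_fun_def w_def by (meson less_imp_le)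
    then have 1: "f w - ereal (\<mu> / 2 * (norm w)\<^sup>2)
        \<le> ereal ((1 - s) * (b - \<mu> / 2 * (norm a)\<^sup>2) + s * (t - \<mu> / 2 * (norm v)\<^sup>2))"
      by (simp add: fa fv)
    have "w - a = s *\<^sub>R (v - a)"
      by (simp add: w_def algebra_simps)
    moreover have "f a + ereal (u \<bullet> (w - a)) \<le> f w"
      using u by (simp add: subdifferential_def)
    ultimately have 2: "ereal (b + s * (u \<bullet> (v - a))) \<le> f w"
      by (simp add: fa)
    \<comment> \<open>The gap between upper and lower bound, sorted by powers of \<open>s\<close>
      for \<open>linear_term_nonneg\<close>; \<open>U\<close> stands for the inner product,
      \<open>m\<close> for \<open>\<mu> / 2\<close>, and \<open>D\<close>, \<open>A\<close>,
      \<open>V\<close> for squared norms.\<close>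
    have alg: "s * (t - b - U - m * D) + s\<^sup>2 * (m * D)
        = ((1 - s) * (b - m * A) + s * (t - m * V)) - (b + s * U - m * ((1 - s) * A + s * V - s * (1 - s) * D))"
      for U m D A V :: real
      by (simp add: algebra_simps power2_eq_square)
    have "b + s * (u \<bullet> (v - a)) - \<mu> / 2 * (norm w)\<^sup>2
        \<le> (1 - s) * (b - \<mu> / 2 * (norm a)\<^sup>2) + s * (t - \<mu> / 2 * (norm v)\<^sup>2)"
      using 1 2 by (cases "f w") auto
    moreover
    have "(norm w)\<^sup>2 = (1 - s) * (norm a)\<^sup>2 + s * (norm v)\<^sup>2 - s * (1 - s) * (norm (v - a))\<^sup>2"
      unfolding w_def power2_norm_eq_inner
      by (simp add: algebra_simps inner_commute)
    ultimately show "0 \<le> s * (t - b - u \<bullet> (v - a) - \<mu> / 2 * (norm (v - a))\<^sup>2)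
        + s\<^sup>2 * (\<mu> / 2 * (norm (v - a))\<^sup>2)"
      unfolding alg[where A = "(norm a)\<^sup>2" and V = "(norm v)\<^sup>2"] by simp
  qed
  then show ?thesis
    by simp
qed

text \<open>Each of the two strengthened subgradient inequalities contributes
  \<open>\<mu> / 2\<close>.\<close>

lemma subdifferential_strongly_monotone:
  assumes "proper_fun f" "strongly_convex_fun \<mu> f"
    and "u \<in> subdifferential f a" "v \<in> subdifferential f b"
  shows "\<mu> * (norm (a - b))\<^sup>2 \<le> (u - v) \<bullet> (a - b)"
proof -
  obtain c where c: "f a = ereal c"
    using subdifferential_finite assms by blast
  obtain d where d: "f b = ereal d"
    using subdifferential_finite assms by blast
  show ?thesis
    using strongly_convex_subgradient[OF assms(2,3) c d] strongly_convex_subgradient[OF assms(2,4) d c]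
    by (simp add: algebra_simps norm_minus_commute)
qed

section \<open>Smooth convex functions\<close>

text \<open>The Riesz vector of the derivative \<open>D\<close> is \<open>adjoint D 1\<close>.
  Uniqueness of the derivative makes it the only candidate, so the definite description in
  \<open>gradient\<close> denotes it.\<close>

lemma gradient_works:
  fixes f :: "'a::euclidean_space \<Rightarrow> real"
  assumes "f differentiable (at x)"
  shows "(f has_derivative (\<lambda>h. h \<bullet> gradient f x)) (at x)"
proof -
  obtain D where D: "(f has_derivative D) (at x)"
    using assms by (auto simp: differentiable_def)
  have "linear D"
    using D has_derivative_linear by blast
  then have D_eq: "D = (\<lambda>h. h \<bullet> adjoint D 1)"
    using adjoint_works[of D _ 1] by auto
  have "GDERIV f x :> adjoint D 1"
    using D D_eq unfolding gderiv_def by metis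
  moreover have "E = adjoint D 1" if "GDERIV f x :> E" for E
  proof -
    have "(\<lambda>h. h \<bullet> E) = (\<lambda>h. h \<bullet> adjoint D 1)"
      using that \<open>GDERIV f x :> adjoint D 1\<close> unfolding gderiv_def by (rule has_derivative_unique)
    then show ?thesis
      by (metis inner_commute vector_eq_ldot)
  qed
  ultimately have "GDERIV f x :> gradient f x"
    unfolding gradient_def by (rule theI)
  then show ?thesis
    by (simp add: gderiv_def)
qed

lemma has_field_derivative_along_line:
  fixes f :: "'a::euclidean_space \<Rightarrow> real"
  assumes "f differentiable (at (x + t *\<^sub>R d))"
  shows "((\<lambda>t. f (x + t *\<^sub>R d)) has_field_derivative d \<bullet> gradient f (x + t *\<^sub>R d)) (at t)"
proof -
  have "((\<lambda>t. x + t *\<^sub>R d) has_derivative (\<lambda>s. s *\<^sub>R d)) (at t)"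
    by (auto intro!: derivative_eq_intros)
  from has_derivative_compose[OF this gradient_works[OF assms]] show ?thesis
    by (simp add: has_field_derivative_def mult_commute_abs)
qed

text \<open>By convexity the difference quotients along the segment from \<open>x\<close> to
  \<open>z\<close> are at most \<open>f z - f x\<close>; pass to the limit.\<close>

lemma convex_gradient_inequality:
  fixes f :: "'a::euclidean_space \<Rightarrow> real"
  assumes conv: "convex_on UNIV f" and diff: "f differentiable (at x)"
  shows "f x + gradient f x \<bullet> (z - x) \<le> f z"
proof -
  define \<phi> where "\<phi> = (\<lambda>t. f (x + t *\<^sub>R (z - x)))"
  have "(\<phi> has_field_derivative (z - x) \<bullet> gradient f x) (at 0)"
    using has_field_derivative_along_line[of f x 0 "z - x"] diff by (simp add: \<phi>_def)
  then have lim: "((\<lambda>t. (\<phi> t - \<phi> 0) / t) \<longlongrightarrow> (z - x) \<bullet> gradient f x) (at_right 0)"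
    by (auto simp: has_field_derivative_iff intro: tendsto_mono[OF at_le])
  have "eventually (\<lambda>t::real. 0 < t \<and> t < 1) (at_right 0)"
    by (auto simp: eventually_at_right_field intro: exI[of _ 1])
  then have ev: "\<forall>\<^sub>F t in at_right 0. (\<phi> t - \<phi> 0) / t \<le> f z - f x"
  proof (rule eventually_mono)
    fix t :: real
    assume t: "0 < t \<and> t < 1"
    have "f ((1 - t) *\<^sub>R x + t *\<^sub>R z) \<le> (1 - t) * f x + t * f z"
      using conv t by (auto intro: convex_onD)
    moreover have "(1 - t) *\<^sub>R x + t *\<^sub>R z = x + t *\<^sub>R (z - x)"
      by (simp add: algebra_simps)
    ultimately show "(\<phi> t - \<phi> 0) / t \<le> f z - f x"
      using t by (simp add: \<phi>_def field_simps)
  qed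
  have "(z - x) \<bullet> gradient f x \<le> f z - f x"
    by (rule tendsto_upperbound[OF lim ev]) simp
  then show ?thesis
    by (simp add: inner_commute)
qed

lemma subgradient_eq_gradient:
  fixes f :: "'a::euclidean_space \<Rightarrow> real"
  assumes diff: "f differentiable (at x)" and sub: "\<And>z. f x + u \<bullet> (z - x) \<le> f z"
  shows "u = gradient f x"
proof -
  \<comment> \<open>In this direction the derivative of \<open>f\<close> minus its affine minorant
    is \<open>d \<bullet> d\<close>; it vanishes because that difference is least at 0.\<close>
  define d where "d = gradient f x - u"
  define \<phi> where "\<phi> = (\<lambda>t. f (x + t *\<^sub>R d) - t * (u \<bullet> d))"
  have "(\<phi> has_field_derivative d \<bullet> gradient f x - u \<bullet> d) (at 0)"
    unfolding \<phi>_def using has_field_derivative_along_line[of f x 0 d] diff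
    by (auto intro!: derivative_eq_intros)
  moreover have "\<phi> 0 \<le> \<phi> t" for t
    using sub[of "x + t *\<^sub>R d"] by (simp add: \<phi>_def)
  ultimately have "d \<bullet> gradient f x - u \<bullet> d = 0"
    by (intro DERIV_local_min[of \<phi> _ 0 1]) auto
  then have "d \<bullet> d = 0"
    by (simp add: d_def algebra_simps inner_commute)
  then show ?thesis
    by (simp add: d_def)
qed

text \<open>The descent lemma. Along the segment, the excess of \<open>f\<close> over the quadratic
  model has nonpositive derivative by the Lipschitz bound on the gradient, so it does not increase
  from \<open>x\<close> to \<open>z\<close>.\<close>

lemma smooth_descent:
  fixes f :: "'a::euclidean_space \<Rightarrow> real"
  assumes smooth: "smooth_fun c f"
  shows "f z \<le> f x + gradient f x \<bullet> (z - x) + c / 2 * (norm (z - x))\<^sup>2"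
proof -
  define d where "d = z - x"
  define \<phi> where "\<phi> = (\<lambda>t. f (x + t *\<^sub>R d) - t * (gradient f x \<bullet> d) - c * t\<^sup>2 / 2 * (norm d)\<^sup>2)"
  have "\<phi> 1 \<le> \<phi> 0"
  proof (rule DERIV_nonpos_imp_nonincreasing[where f = \<phi> and a = 0 and b = 1])
    fix t :: real
    assume t: "0 \<le> t" "t \<le> 1"
    have "f differentiable (at (x + t *\<^sub>R d))"
      using smooth by (simp add: smooth_fun_def)
    from has_field_derivative_along_line[OF this]
    have deriv: "(\<phi> has_field_derivative
        (d \<bullet> gradient f (x + t *\<^sub>R d) - gradient f x \<bullet> d - c * t * (norm d)\<^sup>2)) (at t)"
      unfolding \<phi>_def by (auto intro!: derivative_eq_intros)
    have "(gradient f (x + t *\<^sub>R d) - gradient f x) \<bullet> d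
        \<le> norm (gradient f (x + t *\<^sub>R d) - gradient f x) * norm d"
      by (rule norm_cauchy_schwarz)
    also have "\<dots> \<le> (c * norm (t *\<^sub>R d)) * norm d"
      using smooth lipschitz_onD[of c UNIV "gradient f" "x + t *\<^sub>R d" x]
      by (intro mult_right_mono) (auto simp: smooth_fun_def dist_norm)
    finally have "d \<bullet> gradient f (x + t *\<^sub>R d) - gradient f x \<bullet> d - c * t * (norm d)\<^sup>2 \<le> 0"
      using t by (simp add: algebra_simps inner_commute power2_eq_square)
    with deriv show "\<exists>y. DERIV \<phi> t :> y \<and> y \<le> 0"
      by blast
  qed simp
  then show ?thesis
    by (simp add: \<phi>_def d_def)
qed

text \<open>Baillon--Haddad: compare the tangent plane at \<open>v\<close> with the quadratic upper bound at \<open>w\<close>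
  at the minimizer of their difference.\<close>

lemma convex_smooth_lower_bound:
  fixes f :: "'a::euclidean_space \<Rightarrow> real"
  assumes conv: "convex_on UNIV f" and smooth: "smooth_fun c f" and c: "0 < c"
  shows "f v + gradient f v \<bullet> (w - v) + 1 / (2 * c) * (norm (gradient f w - gradient f v))\<^sup>2 \<le> f w"
proof -
  define e where "e = gradient f w - gradient f v"
  define z where "z = w - (1 / c) *\<^sub>R e"
  have "f v + gradient f v \<bullet> (z - v) \<le> f z"
    using conv smooth by (intro convex_gradient_inequality) (auto simp: smooth_fun_def)
  also have "\<dots> \<le> f w + gradient f w \<bullet> (z - w) + c / 2 * (norm (z - w))\<^sup>2"
    by (rule smooth_descent[OF smooth])
  also have "c / 2 * (norm (z - w))\<^sup>2 = 1 / (2 * c) * (norm e)\<^sup>2"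
    using c by (simp add: z_def power_divide power2_eq_square)
  finally have "f v + gradient f v \<bullet> (w - v) + gradient f v \<bullet> (z - w)
      \<le> f w + gradient f w \<bullet> (z - w) + 1 / (2 * c) * (norm e)\<^sup>2"
    by (simp add: algebra_simps)
  moreover have "gradient f w \<bullet> (z - w) - gradient f v \<bullet> (z - w) = - (1 / c) * (norm e)\<^sup>2"
    unfolding inner_diff_left[symmetric] e_def[symmetric] by (simp add: z_def power2_norm_eq_inner)
  moreover have "1 / c * (norm e)\<^sup>2 = 2 * (1 / (2 * c) * (norm e)\<^sup>2)"
    by simp
  ultimately show ?thesis
    unfolding e_def[symmetric] by linarith
qed

text \<open>Add the preceding lower bound to itself with \<open>v\<close> and \<open>w\<close>
  exchanged.\<close>

lemma gradient_cocoercive: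
  fixes f :: "'a::euclidean_space \<Rightarrow> real"
  assumes "convex_on UNIV f" "smooth_fun c f" "0 < c"
  shows "1 / c * (norm (gradient f v - gradient f w))\<^sup>2 \<le> (gradient f v - gradient f w) \<bullet> (v - w)"
  using convex_smooth_lower_bound[OF assms, of v w] convex_smooth_lower_bound[OF assms, of w v]
  by (simp add: norm_minus_commute algebra_simps)

section \<open>Bounds on the Bregman divergence\<close>

lemma bregman_nonneg:
  fixes f :: "'a::euclidean_space \<Rightarrow> real"
  assumes "convex_on UNIV f" "smooth_fun c f"
  shows "0 \<le> bregman f x x'"
  using convex_gradient_inequality[OF assms(1), of x' x] assms(2)
  by (simp add: bregman_def smooth_fun_def)

lemma bregman_le_square:
  fixes f :: "'a::euclidean_space \<Rightarrow> real"
  assumes "smooth_fun c f"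
  shows "bregman f x x' \<le> c / 2 * (norm (x - x'))\<^sup>2"
  using smooth_descent[OF assms, of x x'] by (simp add: bregman_def)

text \<open>The right-hand side equals \<open>bregman f x x' + bregman f x' x\<close>, and the
  second divergence is nonnegative.\<close>

lemma bregman_le_gradient_diff:
  fixes f :: "'a::euclidean_space \<Rightarrow> real"
  assumes "convex_on UNIV f" "smooth_fun c f"
  shows "bregman f x x' \<le> (gradient f x - gradient f x') \<bullet> (x - x')"
  using convex_gradient_inequality[OF assms(1), of x x'] assms(2)
  by (simp add: bregman_def smooth_fun_def algebra_simps)

section \<open>Conjugates of smooth convex functions\<close>

lemma convex_fun_ereal_iff:
  "convex_fun (\<lambda>x. ereal (h x)) \<longleftrightarrow> convex_on UNIV h"
proof
  assume h: "convex_fun (\<lambda>x. ereal (h x))"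
  show "convex_on UNIV h"
  proof (rule convex_onI)
    fix t :: real and x y
    assume "0 < t" "t < 1"
    then show "h ((1 - t) *\<^sub>R x + t *\<^sub>R y) \<le> (1 - t) * h x + t * h y"
      using h[unfolded convex_fun_def, rule_format, of t x y] by simp
  qed simp
next
  assume "convex_on UNIV h"
  then show "convex_fun (\<lambda>x. ereal (h x))"
    by (auto simp: convex_fun_def intro: convex_onD)
qed

text \<open>The equality case of Fenchel--Young: by the tangent plane inequality the supremum is
  attained at \<open>v\<close>.\<close>

lemma convex_conjugate_gradient:
  fixes h :: "'a::euclidean_space \<Rightarrow> real"
  assumes "convex_on UNIV h" "h differentiable (at v)"
  shows "convex_conjugate (\<lambda>x. ereal (h x)) (gradient h v) = ereal (v \<bullet> gradient h v - h v)"
proof (rule antisym)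
  show "convex_conjugate (\<lambda>x. ereal (h x)) (gradient h v) \<le> ereal (v \<bullet> gradient h v - h v)"
    unfolding convex_conjugate_def
    using convex_gradient_inequality[OF assms]
    by (auto intro!: SUP_least simp: inner_diff_right inner_commute algebra_simps)
qed (rule convex_conjugate_upper)

lemma proper_convex_conjugate:
  fixes h :: "'a::euclidean_space \<Rightarrow> real"
  assumes "convex_on UNIV h" "h differentiable (at v)"
  shows "proper_fun (convex_conjugate (\<lambda>x. ereal (h x)))"
  unfolding proper_fun_def
proof
  show "\<forall>u. convex_conjugate (\<lambda>x. ereal (h x)) u \<noteq> -\<infinity>"
  proof
    fix u
    show "convex_conjugate (\<lambda>x. ereal (h x)) u \<noteq> -\<infinity>"
      using convex_conjugate_upper[of v u h] by auto
  qed
  show "\<exists>u. convex_conjugate (\<lambda>x. ereal (h x)) u \<noteq> \<infinity>"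
    by (rule exI[of _ "gradient h v"]) (simp add: convex_conjugate_gradient[OF assms])
qed

text \<open>Testing the subgradient inequality at \<open>gradient h v\<close>, where the conjugate
  is known, gives \<open>b \<le> v \<bullet> u - h v\<close>. Together with Fenchel--Young at
  \<open>w\<close> this makes \<open>u\<close> a subgradient of \<open>h\<close> at
  \<open>v\<close>.\<close>

lemma subdifferential_conjugate_gradient:
  fixes h :: "'a::euclidean_space \<Rightarrow> real"
  assumes conv: "convex_on UNIV h" and diff: "h differentiable (at v)"
    and v: "v \<in> subdifferential (convex_conjugate (\<lambda>x. ereal (h x))) u"
  shows "u = gradient h v"
proof (rule subgradient_eq_gradient[OF diff])
  fix w
  obtain b where b: "convex_conjugate (\<lambda>x. ereal (h x)) u = ereal b"
    using subdifferential_finite[OF proper_convex_conjugate[OF conv diff] v] .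
  have "b + v \<bullet> (gradient h v - u) \<le> v \<bullet> gradient h v - h v"
    using subdifferentialD[OF v b convex_conjugate_gradient[OF conv diff]] .
  moreover have "w \<bullet> u - h w \<le> b"
    using convex_conjugate_upper[of w u h] b by simp
  ultimately show "h v + u \<bullet> (w - v) \<le> h w"
    by (simp add: algebra_simps inner_commute)
qed

text \<open>Since \<open>a\<close> and \<open>b\<close> are the gradients of \<open>h\<close> at
  \<open>v\<close> and \<open>w\<close>, this is cocoercivity of \<open>gradient h\<close> read for
  the inverse relation.\<close>

lemma subdifferential_conjugate_strongly_monotone:
  fixes h :: "'a::euclidean_space \<Rightarrow> real"
  assumes conv: "convex_on UNIV h" and smooth: "smooth_fun (1 / \<mu>) h" and \<mu>: "0 < \<mu>"
    and "v \<in> subdifferential (convex_conjugate (\<lambda>x. ereal (h x))) a"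
    and "w \<in> subdifferential (convex_conjugate (\<lambda>x. ereal (h x))) b"
  shows "\<mu> * (norm (a - b))\<^sup>2 \<le> (v - w) \<bullet> (a - b)"
proof -
  have "h differentiable (at z)" for z
    using smooth by (simp add: smooth_fun_def)
  then have "a = gradient h v" "b = gradient h w"
    using subdifferential_conjugate_gradient[OF conv] assms(4,5) by blast+
  then show ?thesis
    using gradient_cocoercive[OF conv smooth, of v w] \<mu> by (simp add: inner_commute)
qed

section \<open>The deterministic step\<close>

text \<open>The squared norm of \<open>adjoint L y\<close> is
  \<open>L (adjoint L y) \<bullet> y\<close>; apply Cauchy--Schwarz and the operator norm, then
  cancel one factor.\<close>

lemma norm_adjoint_le:
  fixes L :: "'a::euclidean_space \<Rightarrow> 'b::euclidean_space"
  assumes "linear L"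
  shows "norm (adjoint L y) \<le> onorm L * norm y"
proof -
  have "norm (adjoint L y) * norm (adjoint L y) = L (adjoint L y) \<bullet> y"
    using adjoint_works[OF assms, of "adjoint L y" y]
    by (simp add: power2_norm_eq_inner[symmetric] power2_eq_square)
  also have "\<dots> \<le> norm (L (adjoint L y)) * norm y"
    by (rule norm_cauchy_schwarz)
  also have "\<dots> \<le> (onorm L * norm (adjoint L y)) * norm y"
    using assms by (intro mult_right_mono onorm) (simp_all add: linear_linear)
  finally have "norm (adjoint L y) * norm (adjoint L y) \<le> (onorm L * norm y) * norm (adjoint L y)"
    by (simp add: ac_simps)
  moreover have "0 \<le> onorm L * norm y"
    using assms by (simp add: onorm_pos_le linear_linear)
  ultimately show ?thesis
    by (cases "adjoint L y = 0") (auto simp: mult_le_cancel_right)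
qed

lemma norm_adjoint_square_le:
  fixes L :: "'a::euclidean_space \<Rightarrow> 'b::euclidean_space"
  assumes "linear L"
  shows "(norm (adjoint L y))\<^sup>2 \<le> (onorm L)\<^sup>2 * (norm y)\<^sup>2"
  using power_mono[OF norm_adjoint_le[OF assms, of y], of 2] by (simp add: power_mult_distrib)

section \<open>The weighted norm on the dual space\<close>

lemma dual_norm_sq_le:
  "dual_norm_sq \<gamma> \<tau> L y \<le> \<gamma> / \<tau> * (norm y)\<^sup>2"
  by (simp add: dual_norm_sq_def)

lemma dual_norm_sq_nonneg:
  assumes "linear L" "0 < \<gamma>" "0 < \<tau>" "\<gamma> * \<tau> * (onorm L)\<^sup>2 < 1"
  shows "0 \<le> dual_norm_sq \<gamma> \<tau> L y"
proof -
  have "\<gamma>\<^sup>2 * (norm (adjoint L y))\<^sup>2 \<le> \<gamma>\<^sup>2 * ((onorm L)\<^sup>2 * (norm y)\<^sup>2)"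
    using norm_adjoint_square_le[OF assms(1)] by (intro mult_left_mono) auto
  also have "\<dots> = \<gamma> / \<tau> * (\<gamma> * \<tau> * (onorm L)\<^sup>2) * (norm y)\<^sup>2"
    using assms by (simp add: power2_eq_square)
  also have "\<dots> \<le> \<gamma> / \<tau> * 1 * (norm y)\<^sup>2"
    using assms by (intro mult_right_mono mult_left_mono) auto
  finally show ?thesis
    by (simp add: dual_norm_sq_def)
qed

lemma continuous_on_adjoint:
  fixes L :: "'a::euclidean_space \<Rightarrow> 'b::euclidean_space"
  assumes "linear L"
  shows "continuous_on A (adjoint L)"
  using adjoint_linear[OF assms] by (simp add: linear_continuous_on linear_linear)

lemma dual_norm_sq_measurable:
  fixes L :: "'a::euclidean_space \<Rightarrow> 'b::euclidean_space"
  assumes "linear L"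
  shows "dual_norm_sq \<gamma> \<tau> L \<in> borel_measurable borel"
  unfolding dual_norm_sq_def
  by (intro borel_measurable_continuous_onI continuous_intros continuous_on_adjoint[OF assms])

text \<open>The vectors below stand for differences between the iterates and the fixed point; \<open>dy'\<close> and
  \<open>dp'\<close> belong to the next iterate.\<close>

lemma pddy_dual_step:
  fixes L :: "'a::euclidean_space \<Rightarrow> 'b::euclidean_space"
  assumes L: "linear L" and \<gamma>: "0 < \<gamma>" and \<tau>: "0 < \<tau>" and "\<gamma> * \<tau> * (onorm L)\<^sup>2 < 1"
    and dx: "dx = dp - \<gamma> *\<^sub>R adjoint L dy'"
    and H: "\<mu> * (norm dy')\<^sup>2 \<le> ((1 / \<tau>) *\<^sub>R (dy - dy') + L (dp - \<gamma> *\<^sub>R adjoint L dy)) \<bullet> dy'"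
  shows "dual_norm_sq \<gamma> \<tau> L dy' + 2 * \<gamma> * \<mu> * (norm dy')\<^sup>2
    \<le> dual_norm_sq \<gamma> \<tau> L dy + 2 * \<gamma> * (adjoint L dy' \<bullet> dx)"
proof -
  define q where "q = adjoint L dy'"
  define w where "w = adjoint L dy"
  have wq: "adjoint L (dy - dy') = w - q"
    using adjoint_linear[OF L] by (simp add: linear_diff w_def q_def)
  have "L (dp - \<gamma> *\<^sub>R w) \<bullet> dy' = (dp - \<gamma> *\<^sub>R w) \<bullet> q"
    using adjoint_works[OF L] by (simp add: q_def)
  also have "\<dots> = (dx + \<gamma> *\<^sub>R q - \<gamma> *\<^sub>R w) \<bullet> q"
    by (simp add: dx q_def)
  finally have inner_q: "L (dp - \<gamma> *\<^sub>R w) \<bullet> dy' = (dx + \<gamma> *\<^sub>R q - \<gamma> *\<^sub>R w) \<bullet> q" .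
  \<comment> \<open>Both inner products are polarized. The resulting squares, weighted by
    \<open>\<gamma> / \<tau>\<close> and \<open>\<gamma>\<^sup>2\<close>, pair up into
    \<open>dual_norm_sq\<close> of \<open>dy\<close>, \<open>dy'\<close> and
    \<open>dy - dy'\<close>.\<close>
  have "2 * \<gamma> * (((1 / \<tau>) *\<^sub>R (dy - dy')) \<bullet> dy')
      = \<gamma> / \<tau> * (2 * ((dy - dy') \<bullet> dy'))"
    by simp
  also have "2 * ((dy - dy') \<bullet> dy') = (norm dy)\<^sup>2 - (norm dy')\<^sup>2 - (norm (dy - dy'))\<^sup>2"
    unfolding power2_norm_eq_inner by (simp add: inner_diff inner_commute)
  finally have "2 * \<gamma> * (((1 / \<tau>) *\<^sub>R (dy - dy')) \<bullet> dy')
      = \<gamma> / \<tau> * (norm dy)\<^sup>2 - \<gamma> / \<tau> * (norm dy')\<^sup>2 - \<gamma> / \<tau> * (norm (dy - dy'))\<^sup>2"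
    by (simp only: right_diff_distrib)
  moreover have "2 * \<gamma> * ((dx + \<gamma> *\<^sub>R q - \<gamma> *\<^sub>R w) \<bullet> q)
      = 2 * \<gamma> * (q \<bullet> dx) + \<gamma>\<^sup>2 * (norm q)\<^sup>2 - \<gamma>\<^sup>2 * (norm w)\<^sup>2 + \<gamma>\<^sup>2 * (norm (w - q))\<^sup>2"
    unfolding power2_norm_eq_inner
    by (simp add: inner_diff inner_add inner_commute power2_eq_square algebra_simps)
  ultimately have "2 * \<gamma> * (((1 / \<tau>) *\<^sub>R (dy - dy') + L (dp - \<gamma> *\<^sub>R w)) \<bullet> dy')
      = dual_norm_sq \<gamma> \<tau> L dy - dual_norm_sq \<gamma> \<tau> L dy' + 2 * \<gamma> * (q \<bullet> dx)
        - dual_norm_sq \<gamma> \<tau> L (dy - dy')"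
    unfolding inner_add_left distrib_left inner_q dual_norm_sq_def wq q_def[symmetric] w_def[symmetric]
    by simp
  moreover have "2 * \<gamma> * (\<mu> * (norm dy')\<^sup>2)
      \<le> 2 * \<gamma> * (((1 / \<tau>) *\<^sub>R (dy - dy') + L (dp - \<gamma> *\<^sub>R w)) \<bullet> dy')"
    using H \<gamma> by (intro mult_left_mono) (auto simp: w_def)
  \<comment> \<open>The term discarded in the conclusion; its sign comes from the step-size
    condition on \<open>\<gamma> * \<tau>\<close>.\<close>
  moreover have "0 \<le> dual_norm_sq \<gamma> \<tau> L (dy - dy')"
    using dual_norm_sq_nonneg assms by blast
  ultimately show ?thesis
    by (simp add: q_def)
qed

text \<open>A bound on \<open>x k\<close> by quantities of index \<open>k\<close>, used to make it
  square integrable. The cross term of the dual step is \<open>2 * ((dp - dx) \<bullet> dx)\<close>,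
  which polarization bounds by the difference of the squared norms of \<open>dp\<close> and
  \<open>dx\<close>.\<close>

lemma pddy_primal_bound:
  fixes L :: "'a::euclidean_space \<Rightarrow> 'b::euclidean_space"
  assumes "linear L" and "0 < \<gamma>" and "0 < \<tau>" and "\<gamma> * \<tau> * (onorm L)\<^sup>2 < 1"
    and dx: "dx = dp - \<gamma> *\<^sub>R adjoint L dy'"
    and "\<mu> * (norm dy')\<^sup>2 \<le> ((1 / \<tau>) *\<^sub>R (dy - dy') + L (dp - \<gamma> *\<^sub>R adjoint L dy)) \<bullet> dy'"
    and \<mu>: "0 \<le> \<mu>"
  shows "(norm dx)\<^sup>2 \<le> (norm dp)\<^sup>2 + dual_norm_sq \<gamma> \<tau> L dy"
proof -
  have "2 * \<gamma> * (adjoint L dy' \<bullet> dx) = 2 * ((dp - dx) \<bullet> dx)"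
    by (simp add: dx)
  also have "\<dots> = (norm dp)\<^sup>2 - (norm (dp - dx))\<^sup>2 - (norm dx)\<^sup>2"
    unfolding power2_norm_eq_inner by (simp add: inner_diff inner_commute)
  finally have "2 * \<gamma> * (adjoint L dy' \<bullet> dx) \<le> (norm dp)\<^sup>2 - (norm dx)\<^sup>2"
    by simp
  moreover have "0 \<le> 2 * \<gamma> * \<mu> * (norm dy')\<^sup>2"
    using assms(2) \<mu> by simp
  moreover have "0 \<le> dual_norm_sq \<gamma> \<tau> L dy'"
    using dual_norm_sq_nonneg assms by blast
  ultimately show ?thesis
    using pddy_dual_step[OF assms(1-6)] by linarith
qed

text \<open>The cross terms \<open>2 * \<gamma> * (q \<bullet> dx)\<close> of the primal and the
  dual inequality have opposite signs and cancel. The rest distributes the strong monotonicity gains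
  over the two weights on the left.\<close>

lemma pddy_step_inequality:
  fixes L :: "'a::euclidean_space \<Rightarrow> 'b::euclidean_space"
  assumes L: "linear L" and \<gamma>: "0 < \<gamma>" and \<tau>: "0 < \<tau>" and "\<gamma> * \<tau> * (onorm L)\<^sup>2 < 1"
    and dx: "dx = dp - \<gamma> *\<^sub>R adjoint L dy'"
    and "\<mu> * (norm dy')\<^sup>2 \<le> ((1 / \<tau>) *\<^sub>R (dy - dy') + L (dp - \<gamma> *\<^sub>R adjoint L dy)) \<bullet> dy'"
    and dp': "dp' = dp + ds - dx"
    and R: "\<gamma> * (m * (norm ds)\<^sup>2) \<le> (2 *\<^sub>R dx - dp - \<gamma> *\<^sub>R dg - ds) \<bullet> ds"
    and m: "0 \<le> m" and \<eta>: "\<eta> = 2 * (\<mu> - \<gamma>\<^sup>2 * (onorm L)\<^sup>2 * m)" and \<eta>_nonneg: "0 \<le> \<eta>"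
  shows "(1 + \<gamma> * m) * (norm dp')\<^sup>2 + (1 + \<tau> * \<eta>) * dual_norm_sq \<gamma> \<tau> L dy'
    \<le> (norm dp)\<^sup>2 + dual_norm_sq \<gamma> \<tau> L dy - 2 * \<gamma> * (dg \<bullet> dx) + \<gamma>\<^sup>2 * (norm dg)\<^sup>2"
proof -
  define q where "q = adjoint L dy'"
  define N where "N = dual_norm_sq \<gamma> \<tau> L"
  have dp: "dp = dx + \<gamma> *\<^sub>R q"
    by (simp add: dx q_def)
  have "(norm dp)\<^sup>2 - 2 * \<gamma> * (q \<bullet> dx) - 2 * \<gamma> * (dg \<bullet> dx) + \<gamma>\<^sup>2 * (norm dg)\<^sup>2 - (norm dp')\<^sup>2
      = 2 * ((2 *\<^sub>R dx - dp - \<gamma> *\<^sub>R dg - ds) \<bullet> ds) + (norm (ds - dx + \<gamma> *\<^sub>R dg))\<^sup>2"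
    unfolding dp' dp power2_norm_eq_inner
    by (simp add: inner_commute inner_diff inner_add power2_eq_square algebra_simps)
  moreover have "0 \<le> (norm (ds - dx + \<gamma> *\<^sub>R dg))\<^sup>2"
    by simp
  ultimately have primal: "(norm dp')\<^sup>2 + 2 * \<gamma> * m * (norm ds)\<^sup>2
      \<le> (norm dp)\<^sup>2 - 2 * \<gamma> * (q \<bullet> dx) - 2 * \<gamma> * (dg \<bullet> dx) + \<gamma>\<^sup>2 * (norm dg)\<^sup>2"
    using R by (simp only: mult.assoc)
  have dual: "N dy' + 2 * \<gamma> * \<mu> * (norm dy')\<^sup>2 \<le> N dy + 2 * \<gamma> * (q \<bullet> dx)"
    unfolding N_def q_def by (rule pddy_dual_step[OF assms(1-6)])
  \<comment> \<open>The parallelogram law, as \<open>dp' = ds + \<gamma> *\<^sub>R q\<close>; it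
    converts the gain in \<open>ds\<close> into one in \<open>dp'\<close> at the cost of a term in
    \<open>q\<close>.\<close>
  have "(norm dp')\<^sup>2 + (norm (ds - \<gamma> *\<^sub>R q))\<^sup>2 = 2 * (norm ds)\<^sup>2 + 2 * \<gamma>\<^sup>2 * (norm q)\<^sup>2"
    unfolding dp' dp power2_norm_eq_inner
    by (simp add: inner_commute inner_diff inner_add power2_eq_square)
  then have "(norm dp')\<^sup>2 \<le> 2 * (norm ds)\<^sup>2 + 2 * \<gamma>\<^sup>2 * (norm q)\<^sup>2"
    using zero_le_power2[of "norm (ds - \<gamma> *\<^sub>R q)"] by linarith
  also have "\<dots> \<le> 2 * (norm ds)\<^sup>2 + 2 * \<gamma>\<^sup>2 * ((onorm L)\<^sup>2 * (norm dy')\<^sup>2)"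
    unfolding q_def using norm_adjoint_square_le[OF L, of dy'] by (intro add_left_mono mult_left_mono) auto
  finally have "\<gamma> * m * (norm dp')\<^sup>2
      \<le> \<gamma> * m * (2 * (norm ds)\<^sup>2 + 2 * \<gamma>\<^sup>2 * ((onorm L)\<^sup>2 * (norm dy')\<^sup>2))"
    using m \<gamma> by (intro mult_left_mono) auto
  \<comment> \<open>The cost is paid from the dual gain; \<open>\<eta>\<close> is defined so that
    \<open>\<gamma> * \<eta> * (norm dy')\<^sup>2\<close> is what remains of it.\<close>
  then have p: "\<gamma> * m * (norm dp')\<^sup>2
      \<le> 2 * \<gamma> * m * (norm ds)\<^sup>2 + 2 * \<gamma> * \<mu> * (norm dy')\<^sup>2 - \<gamma> * \<eta> * (norm dy')\<^sup>2"
    by (simp add: \<eta> algebra_simps)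
  have "\<tau> * \<eta> * N dy' \<le> \<tau> * \<eta> * (\<gamma> / \<tau> * (norm dy')\<^sup>2)"
    using \<tau> \<eta>_nonneg dual_norm_sq_le unfolding N_def by (intro mult_left_mono) auto
  then have "\<tau> * \<eta> * N dy' \<le> \<gamma> * \<eta> * (norm dy')\<^sup>2"
    using \<tau> by (simp add: ac_simps)
  then show ?thesis
    using primal dual p unfolding N_def[symmetric] by (simp add: distrib_right)
qed

text \<open>Subtracting the inclusions satisfied by the solution from the optimality conditions of
  the two proximal steps, and applying strong monotonicity, yields the hypotheses of the two
  preceding lemmas.\<close>

lemma pddy_path_step:
  fixes F :: "'a::euclidean_space \<Rightarrow> real" and H :: "'b::euclidean_space \<Rightarrow> ereal" and L :: "'a \<Rightarrow> 'b"
  assumes L: "linear L" and R: "pcl_fun R" and H: "pcl_fun H"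
    and sol: "primal_dual_solution F R H L xs ys"
    and \<gamma>: "0 < \<gamma>" and \<tau>: "0 < \<tau>" and ps: "ps = xs + \<gamma> *\<^sub>R adjoint L ys"
    and path: "pddy_path \<gamma> \<tau> L R H p0 y0 g p y x s"
    and \<mu>R: "0 < \<mu>R" and \<mu>H: "0 < \<mu>H"
    and H_smooth: "smooth_efun (1 / \<mu>H) H" and R_strong: "strongly_convex_fun \<mu>R R"
    and step: "\<gamma> * \<tau> * (onorm L)\<^sup>2 < 1"
    and \<eta>: "\<eta> = 2 * (\<mu>H - \<gamma>\<^sup>2 * (onorm L)\<^sup>2 * \<mu>R)" "0 \<le> \<eta>"
  shows "(norm (x k - xs))\<^sup>2 \<le> (norm (p k - ps))\<^sup>2 + dual_norm_sq \<gamma> \<tau> L (y k - ys)"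
    and "(1 + \<gamma> * \<mu>R) * (norm (p (Suc k) - ps))\<^sup>2 + (1 + \<tau> * \<eta>) * dual_norm_sq \<gamma> \<tau> L (y (Suc k) - ys)
      \<le> (norm (p k - ps))\<^sup>2 + dual_norm_sq \<gamma> \<tau> L (y k - ys)
        - 2 * \<gamma> * ((g (Suc k) - gradient F xs) \<bullet> (x k - xs)) + \<gamma>\<^sup>2 * (norm (g (Suc k) - gradient F xs))\<^sup>2"
proof -
  obtain h where h: "H = (\<lambda>v. ereal (h v))" and h_smooth: "smooth_fun (1 / \<mu>H) h"
    using H_smooth by (auto simp: smooth_efun_def)
  have h_conv: "convex_on UNIV h"
    using H by (simp add: pcl_fun_def h convex_fun_ereal_iff)
  obtain u where u: "u \<in> subdifferential R xs" and u_eq: "gradient F xs + u + adjoint L ys = 0"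
    using sol by (force simp: primal_dual_solution_def)
  have v: "L xs \<in> subdifferential (convex_conjugate H) ys"
    using sol by (simp add: primal_dual_solution_def)
  have A: "adjoint L (a - b) = adjoint L a - adjoint L b" for a b
    using adjoint_linear[OF L] by (rule linear_diff)
  have y_eq: "y (Suc k) = prox (\<lambda>v. ereal \<tau> * convex_conjugate H v) (y k + \<tau> *\<^sub>R L (p k - \<gamma> *\<^sub>R adjoint L (y k)))"
    and x_eq: "x k = p k - \<gamma> *\<^sub>R adjoint L (y (Suc k))"
    and s_eq: "s (Suc k) = prox (\<lambda>v. ereal \<gamma> * R v) (2 *\<^sub>R x k - p k - \<gamma> *\<^sub>R g (Suc k))"
    and p_eq: "p (Suc k) = p k + s (Suc k) - x k"
    using path by (auto simp: pddy_path_def)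
  have "(1 / \<tau>) *\<^sub>R (y k + \<tau> *\<^sub>R L (p k - \<gamma> *\<^sub>R adjoint L (y k)) - y (Suc k))
      \<in> subdifferential (convex_conjugate H) (y (Suc k))"
    unfolding y_eq
  proof (rule prox_subdifferential[OF closed_epigraph_conjugate _ _ v \<tau>])
    have "h differentiable (at 0)"
      using h_smooth by (simp add: smooth_fun_def)
    then show "proper_fun (convex_conjugate H)"
      unfolding h by (rule proper_convex_conjugate[OF h_conv])
    show "convex_fun (convex_conjugate H)"
      unfolding h by (rule convex_conjugate_convex)
  qed
  then have "\<mu>H * (norm (y (Suc k) - ys))\<^sup>2
      \<le> ((1 / \<tau>) *\<^sub>R (y k + \<tau> *\<^sub>R L (p k - \<gamma> *\<^sub>R adjoint L (y k)) - y (Suc k)) - L xs) \<bullet> (y (Suc k) - ys)"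
    using v unfolding h by (rule subdifferential_conjugate_strongly_monotone[OF h_conv h_smooth \<mu>H])
  moreover have "(1 / \<tau>) *\<^sub>R (y k + \<tau> *\<^sub>R L (p k - \<gamma> *\<^sub>R adjoint L (y k)) - y (Suc k)) - L xs
      = (1 / \<tau>) *\<^sub>R ((y k - ys) - (y (Suc k) - ys)) + L ((p k - ps) - \<gamma> *\<^sub>R adjoint L (y k - ys))"
  proof -
    \<comment> \<open>Here the choice of \<open>ps\<close> matters: removing the adjoint term from
      \<open>ps\<close> leaves \<open>xs\<close>.\<close>
    have "(p k - ps) - \<gamma> *\<^sub>R adjoint L (y k - ys) = (p k - \<gamma> *\<^sub>R adjoint L (y k)) - xs"
      by (simp add: ps A algebra_simps)
    then have "L ((p k - ps) - \<gamma> *\<^sub>R adjoint L (y k - ys)) = L (p k - \<gamma> *\<^sub>R adjoint L (y k)) - L xs"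
      by (simp only: linear_diff[OF L, of _ xs])
    then show ?thesis
      using \<tau> by (simp add: scaleR_right_distrib scaleR_right_diff_distrib)
  qed
  ultimately have dual: "\<mu>H * (norm (y (Suc k) - ys))\<^sup>2
      \<le> ((1 / \<tau>) *\<^sub>R ((y k - ys) - (y (Suc k) - ys)) + L ((p k - ps) - \<gamma> *\<^sub>R adjoint L (y k - ys)))
        \<bullet> (y (Suc k) - ys)"
    by simp
  have dx: "x k - xs = (p k - ps) - \<gamma> *\<^sub>R adjoint L (y (Suc k) - ys)"
    by (simp add: x_eq ps A algebra_simps)
  show "(norm (x k - xs))\<^sup>2 \<le> (norm (p k - ps))\<^sup>2 + dual_norm_sq \<gamma> \<tau> L (y k - ys)"
    using pddy_primal_bound[OF L \<gamma> \<tau> step dx dual] \<mu>H by simp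
  have R_proper: "proper_fun R"
    using R by (simp add: pcl_fun_def)
  have "(1 / \<gamma>) *\<^sub>R (2 *\<^sub>R x k - p k - \<gamma> *\<^sub>R g (Suc k) - s (Suc k)) \<in> subdifferential R (s (Suc k))"
    unfolding s_eq using R u \<gamma> by (intro prox_subdifferential closed_epigraph_lsc) (auto simp: pcl_fun_def)
  from subdifferential_strongly_monotone[OF R_proper R_strong this u]
  have "\<gamma> * (\<mu>R * (norm (s (Suc k) - xs))\<^sup>2)
      \<le> \<gamma> * (((1 / \<gamma>) *\<^sub>R (2 *\<^sub>R x k - p k - \<gamma> *\<^sub>R g (Suc k) - s (Suc k)) - u) \<bullet> (s (Suc k) - xs))"
    using \<gamma> by (intro mult_left_mono) auto
  also have "\<dots> = (\<gamma> *\<^sub>R ((1 / \<gamma>) *\<^sub>R (2 *\<^sub>R x k - p k - \<gamma> *\<^sub>R g (Suc k) - s (Suc k)) - u)) \<bullet> (s (Suc k) - xs)"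
    by (simp only: inner_scaleR_left)
  \<comment> \<open>Stationarity expresses \<open>u\<close> through the gradient and the adjoint at
    the solution; the adjoint part is absorbed by \<open>ps - xs\<close>.\<close>
  also have "\<gamma> *\<^sub>R ((1 / \<gamma>) *\<^sub>R (2 *\<^sub>R x k - p k - \<gamma> *\<^sub>R g (Suc k) - s (Suc k)) - u)
      = 2 *\<^sub>R (x k - xs) - (p k - ps) - \<gamma> *\<^sub>R (g (Suc k) - gradient F xs) - (s (Suc k) - xs)"
  proof -
    have u': "u = - gradient F xs - adjoint L ys"
      using u_eq by (simp add: eq_neg_iff_add_eq_0 algebra_simps)
    show ?thesis
      using \<gamma> by (simp add: u' ps scaleR_right_diff_distrib scaleR_right_distrib scaleR_2)
  qed
  finally have primal: "\<gamma> * (\<mu>R * (norm (s (Suc k) - xs))\<^sup>2)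
      \<le> (2 *\<^sub>R (x k - xs) - (p k - ps) - \<gamma> *\<^sub>R (g (Suc k) - gradient F xs) - (s (Suc k) - xs)) \<bullet> (s (Suc k) - xs)" .
  have dp: "p (Suc k) - ps = (p k - ps) + (s (Suc k) - xs) - (x k - xs)"
    by (simp add: p_eq)
  show "(1 + \<gamma> * \<mu>R) * (norm (p (Suc k) - ps))\<^sup>2 + (1 + \<tau> * \<eta>) * dual_norm_sq \<gamma> \<tau> L (y (Suc k) - ys)
      \<le> (norm (p k - ps))\<^sup>2 + dual_norm_sq \<gamma> \<tau> L (y k - ys)
        - 2 * \<gamma> * ((g (Suc k) - gradient F xs) \<bullet> (x k - xs)) + \<gamma>\<^sup>2 * (norm (g (Suc k) - gradient F xs))\<^sup>2"
    using pddy_step_inequality[OF L \<gamma> \<tau> step dx dual dp primal _ \<eta>] \<mu>R by simp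
qed

section \<open>The stochastic step\<close>

text \<open>The tower property, with test function 1. Working in \<open>ennreal\<close> makes
  integrability of \<open>f\<close> a consequence of the conditional bound.\<close>

lemma (in prob_space) integral_le_nn_cond_exp_bound:
  fixes f h :: "'a \<Rightarrow> real"
  assumes sub: "subalgebra M G" and f: "f \<in> borel_measurable M" "\<And>\<omega>. 0 \<le> f \<omega>"
    and h: "integrable M h" "\<And>\<omega>. 0 \<le> h \<omega>"
    and bound: "AE \<omega> in M. nn_cond_exp M G (\<lambda>\<omega>. ennreal (f \<omega>)) \<omega> \<le> ennreal (h \<omega>)"
  shows "integrable M f" and "integral\<^sup>L M f \<le> integral\<^sup>L M h"
proof -
  interpret finite_measure_subalgebra M G
    by unfold_locales (rule sub)
  have "(\<integral>\<^sup>+ \<omega>. ennreal (f \<omega>) \<partial>M) = (\<integral>\<^sup>+ \<omega>. nn_cond_exp M G (\<lambda>\<omega>. ennreal (f \<omega>)) \<omega> \<partial>M)"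
    using nn_cond_exp_intg[of "\<lambda>_. 1" "\<lambda>\<omega>. ennreal (f \<omega>)"] f(1) by simp
  also have "\<dots> \<le> (\<integral>\<^sup>+ \<omega>. ennreal (h \<omega>) \<partial>M)"
    by (rule nn_integral_mono_AE[OF bound])
  also have "\<dots> = ennreal (integral\<^sup>L M h)"
    using h by (intro nn_integral_eq_integral) auto
  finally have le: "(\<integral>\<^sup>+ \<omega>. ennreal (f \<omega>) \<partial>M) \<le> ennreal (integral\<^sup>L M h)" .
  show "integrable M f"
    using f le by (intro integrableI_nonneg) (auto intro: le_less_trans)
  then have "(\<integral>\<^sup>+ \<omega>. ennreal (f \<omega>) \<partial>M) = ennreal (integral\<^sup>L M f)"
    using f by (intro nn_integral_eq_integral) auto
  then show "integral\<^sup>L M f \<le> integral\<^sup>L M h"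
    using le h(2) by (simp add: ennreal_le_iff integral_nonneg)
qed

text \<open>The \<open>G\<close>-measurable factor \<open>d\<close> is pulled out of the conditional
  expectation coordinate by coordinate in \<open>Basis\<close>; square integrability of
  \<open>f\<close> and \<open>d\<close> makes the products integrable.\<close>

lemma (in prob_space) expectation_inner_cond_exp:
  fixes f h d :: "'a \<Rightarrow> 'b::euclidean_space"
  assumes sub: "subalgebra M G" and ce: "has_cond_exp M G f h"
    and d: "d \<in> borel_measurable G"
    and f2: "integrable M (\<lambda>\<omega>. (norm (f \<omega>))\<^sup>2)" and d2: "integrable M (\<lambda>\<omega>. (norm (d \<omega>))\<^sup>2)"
  shows "integrable M (\<lambda>\<omega>. f \<omega> \<bullet> d \<omega>)" "integrable M (\<lambda>\<omega>. h \<omega> \<bullet> d \<omega>)"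
    and "expectation (\<lambda>\<omega>. f \<omega> \<bullet> d \<omega>) = expectation (\<lambda>\<omega>. h \<omega> \<bullet> d \<omega>)"
proof -
  interpret finite_measure_subalgebra M G
    by unfold_locales (rule sub)
  have f: "integrable M f" and h: "integrable M h" and hG: "h \<in> borel_measurable G"
    and eq: "\<And>A. A \<in> sets G \<Longrightarrow> set_lebesgue_integral M A f = set_lebesgue_integral M A h"
    using ce by (auto simp: has_cond_exp_def)
  have dM [measurable]: "d \<in> borel_measurable M"
    by (rule measurable_from_subalg[OF sub d])
  have fM [measurable]: "f \<in> borel_measurable M" and hM [measurable]: "h \<in> borel_measurable M"
    using f h by auto
  have set_inner: "(\<integral>\<omega>\<in>A. k \<omega> \<bullet> b \<partial>M) = set_lebesgue_integral M A k \<bullet> b"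
    if "set_integrable M A k" for A b and k :: "'a \<Rightarrow> 'b"
  proof -
    have "(\<integral>\<omega>\<in>A. k \<omega> \<bullet> b \<partial>M) = (\<integral>\<omega>. (indicator A \<omega> *\<^sub>R k \<omega>) \<bullet> b \<partial>M)"
      by (simp add: set_lebesgue_integral_def)
    also have "\<dots> = set_lebesgue_integral M A k \<bullet> b"
      unfolding set_lebesgue_integral_def
      by (rule integral_inner_left) (use that in \<open>simp add: set_integrable_def\<close>)
    finally show ?thesis .
  qed
  have comp: "integrable M (\<lambda>\<omega>. (f \<omega> \<bullet> b) * (d \<omega> \<bullet> b))" "integrable M (\<lambda>\<omega>. (h \<omega> \<bullet> b) * (d \<omega> \<bullet> b))"
    "expectation (\<lambda>\<omega>. (f \<omega> \<bullet> b) * (d \<omega> \<bullet> b)) = expectation (\<lambda>\<omega>. (h \<omega> \<bullet> b) * (d \<omega> \<bullet> b))"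
    if b: "b \<in> Basis" for b
  proof -
    have dbG: "(\<lambda>\<omega>. d \<omega> \<bullet> b) \<in> borel_measurable G"
      using d by measurable
    have bound: "\<bar>(f \<omega> \<bullet> b) * (d \<omega> \<bullet> b)\<bar> \<le> (norm (f \<omega>))\<^sup>2 + (norm (d \<omega>))\<^sup>2" for \<omega>
    proof -
      have "\<bar>(f \<omega> \<bullet> b) * (d \<omega> \<bullet> b)\<bar> \<le> norm (f \<omega>) * norm (d \<omega>)"
        unfolding abs_mult by (intro mult_mono Basis_le_norm b) auto
      also have "\<dots> \<le> (norm (f \<omega>))\<^sup>2 + (norm (d \<omega>))\<^sup>2"
        using sum_squares_bound[of "norm (f \<omega>)" "norm (d \<omega>)"]
          mult_nonneg_nonneg[OF norm_ge_zero[of "f \<omega>"] norm_ge_zero[of "d \<omega>"]]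
        by (simp only: mult.assoc)
      finally show ?thesis .
    qed
    show fd: "integrable M (\<lambda>\<omega>. (f \<omega> \<bullet> b) * (d \<omega> \<bullet> b))"
      by (rule Bochner_Integration.integrable_bound[OF Bochner_Integration.integrable_add[OF f2 d2]])
        (use bound in auto)
    \<comment> \<open>Taking inner products of the vector integrals over sets of \<open>G\<close>
      with \<open>b\<close> characterizes the conditional expectation of this coordinate.\<close>
    have AE: "AE \<omega> in M. real_cond_exp M G (\<lambda>\<omega>. f \<omega> \<bullet> b) \<omega> = h \<omega> \<bullet> b"
    proof (rule real_cond_exp_charact)
      fix A assume A: "A \<in> sets G"
      then have "A \<in> sets M"
        using sub by (auto simp: subalgebra_def)
      then have "set_integrable M A f" "set_integrable M A h"
        using f h by (auto simp: set_integrable_def intro: integrable_mult_indicator)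
      then show "(\<integral>\<omega>\<in>A. f \<omega> \<bullet> b \<partial>M) = (\<integral>\<omega>\<in>A. h \<omega> \<bullet> b \<partial>M)"
        using arg_cong[OF eq[OF A], of "\<lambda>v. v \<bullet> b"] set_inner[of A] by simp
    qed (use f h hG in auto)
    have fd': "integrable M (\<lambda>\<omega>. (d \<omega> \<bullet> b) * (f \<omega> \<bullet> b))"
      using fd by (simp add: mult.commute)
    have "integrable M (\<lambda>\<omega>. (d \<omega> \<bullet> b) * real_cond_exp M G (\<lambda>\<omega>. f \<omega> \<bullet> b) \<omega>)"
      by (rule real_cond_exp_intg(1)[OF fd' dbG]) measurable
    moreover have AE': "AE \<omega> in M. (d \<omega> \<bullet> b) * real_cond_exp M G (\<lambda>\<omega>. f \<omega> \<bullet> b) \<omega> = (h \<omega> \<bullet> b) * (d \<omega> \<bullet> b)"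
      using AE by eventually_elim simp
    ultimately show "integrable M (\<lambda>\<omega>. (h \<omega> \<bullet> b) * (d \<omega> \<bullet> b))"
      by (subst integrable_cong_AE[symmetric, OF _ _ AE']) auto
    have "expectation (\<lambda>\<omega>. (f \<omega> \<bullet> b) * (d \<omega> \<bullet> b)) = expectation (\<lambda>\<omega>. (d \<omega> \<bullet> b) * (f \<omega> \<bullet> b))"
      by (simp add: mult.commute)
    also have "\<dots> = expectation (\<lambda>\<omega>. (d \<omega> \<bullet> b) * real_cond_exp M G (\<lambda>\<omega>. f \<omega> \<bullet> b) \<omega>)"
      by (rule real_cond_exp_intg(2)[OF fd' dbG, symmetric]) measurable
    also have "\<dots> = expectation (\<lambda>\<omega>. (h \<omega> \<bullet> b) * (d \<omega> \<bullet> b))"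
      by (rule integral_cong_AE[OF _ _ AE']) auto
    finally show "expectation (\<lambda>\<omega>. (f \<omega> \<bullet> b) * (d \<omega> \<bullet> b)) = expectation (\<lambda>\<omega>. (h \<omega> \<bullet> b) * (d \<omega> \<bullet> b))" .
  qed
  have coords: "(\<lambda>\<omega>. f \<omega> \<bullet> d \<omega>) = (\<lambda>\<omega>. \<Sum>b\<in>Basis. (f \<omega> \<bullet> b) * (d \<omega> \<bullet> b))"
    "(\<lambda>\<omega>. h \<omega> \<bullet> d \<omega>) = (\<lambda>\<omega>. \<Sum>b\<in>Basis. (h \<omega> \<bullet> b) * (d \<omega> \<bullet> b))"
    by (rule ext, rule euclidean_inner)+
  show "integrable M (\<lambda>\<omega>. f \<omega> \<bullet> d \<omega>)" "integrable M (\<lambda>\<omega>. h \<omega> \<bullet> d \<omega>)"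
    unfolding coords using comp by auto
  show "expectation (\<lambda>\<omega>. f \<omega> \<bullet> d \<omega>) = expectation (\<lambda>\<omega>. h \<omega> \<bullet> d \<omega>)"
    unfolding coords using comp by (simp add: Bochner_Integration.integral_sum)
qed

text \<open>In the application \<open>U\<close> is the unweighted energy now and \<open>U'\<close>
  the weighted energy after the step. The noise contributes
  \<open>\<gamma>\<^sup>2 * \<beta>\<close> directly and
  \<open>\<kappa> * \<gamma>\<^sup>2 * (1 - \<rho>)\<close> through its recursion, which add up to
  the stated factor.\<close>

lemma (in prob_space) variance_reduced_step:
  fixes F :: "'b::euclidean_space \<Rightarrow> real" and x g :: "'a \<Rightarrow> 'b" and S S' U U' :: "'a \<Rightarrow> real"
  assumes sub: "subalgebra M G"
    and conv: "convex_on UNIV F" and smooth: "smooth_fun \<nu> F"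
    and nonneg: "0 \<le> \<alpha>" "0 \<le> \<beta>" "0 \<le> \<delta>" "\<rho> \<le> 1" "0 < \<kappa>" "0 < \<gamma>"
    and \<gamma>: "\<gamma> * (\<alpha> + \<kappa> * \<delta>) \<le> 1"
    and xG: "x \<in> borel_measurable G" and gM: "g \<in> borel_measurable M"
    and S'M: "S' \<in> borel_measurable M"
    and U'M: "U' \<in> borel_measurable M"
    and U: "integrable M U" and S: "integrable M (\<lambda>\<omega>. (S \<omega>)\<^sup>2)"
    and x2: "integrable M (\<lambda>\<omega>. (norm (x \<omega> - xs))\<^sup>2)"
    and U'_nonneg: "\<And>\<omega>. \<omega> \<in> space M \<Longrightarrow> 0 \<le> U' \<omega>"
    and path: "\<And>\<omega>. \<omega> \<in> space M \<Longrightarrow> U' \<omega> \<le> U \<omega>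
      - 2 * \<gamma> * ((g \<omega> - gradient F xs) \<bullet> (x \<omega> - xs)) + \<gamma>\<^sup>2 * (norm (g \<omega> - gradient F xs))\<^sup>2"
    and ce: "has_cond_exp M G g (\<lambda>\<omega>. gradient F (x \<omega>))"
    and gvar: "AE \<omega> in M. nn_cond_exp M G (\<lambda>\<omega>. ennreal ((norm (g \<omega> - gradient F xs))\<^sup>2)) \<omega>
      \<le> ennreal (2 * \<alpha> * bregman F (x \<omega>) xs + \<beta> * (S \<omega>)\<^sup>2)"
    and Svar: "AE \<omega> in M. nn_cond_exp M G (\<lambda>\<omega>. ennreal ((S' \<omega>)\<^sup>2)) \<omega>
      \<le> ennreal ((1 - \<rho>) * (S \<omega>)\<^sup>2 + 2 * \<delta> * bregman F (x \<omega>) xs)"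
  shows "integrable M U'" and "integrable M (\<lambda>\<omega>. (S' \<omega>)\<^sup>2)"
    and "expectation U' + \<kappa> * \<gamma>\<^sup>2 * expectation (\<lambda>\<omega>. (S' \<omega>)\<^sup>2)
      \<le> expectation U + (1 - \<rho> + \<beta> / \<kappa>) * (\<kappa> * \<gamma>\<^sup>2 * expectation (\<lambda>\<omega>. (S \<omega>)\<^sup>2))"
proof -
  define D where "D = (\<lambda>\<omega>. bregman F (x \<omega>) xs)"
  define c where "c = gradient F xs"
  define d where "d = (\<lambda>\<omega>. x \<omega> - xs)"
  note [measurable] = gM S'M U'M
  have xM [measurable]: "x \<in> borel_measurable M"
    by (rule measurable_from_subalg[OF sub xG])
  have dG: "d \<in> borel_measurable G"
    using xG unfolding d_def by measurable
  have dM [measurable]: "d \<in> borel_measurable M"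
    unfolding d_def by measurable
  have d2: "integrable M (\<lambda>\<omega>. (norm (d \<omega>))\<^sup>2)"
    using x2 by (simp add: d_def)
  have D_nonneg: "0 \<le> D \<omega>" for \<omega>
    unfolding D_def by (rule bregman_nonneg[OF conv smooth])
  have "continuous_on UNIV F"
    using smooth by (auto simp: smooth_fun_def intro!: continuous_at_imp_continuous_on differentiable_imp_continuous_within)
  then have [measurable]: "F \<in> borel_measurable borel"
    by (rule borel_measurable_continuous_onI)
  have DM [measurable]: "D \<in> borel_measurable M"
    unfolding D_def bregman_def by measurable
  \<comment> \<open>The descent lemma dominates the divergence by a multiple of the integrable
    squared distance.\<close>
  have D: "integrable M D"
  proof (rule Bochner_Integration.integrable_bound)
    show "integrable M (\<lambda>\<omega>. \<nu> / 2 * (norm (d \<omega>))\<^sup>2)"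
      using d2 by simp
    show "AE \<omega> in M. norm (D \<omega>) \<le> norm (\<nu> / 2 * (norm (d \<omega>))\<^sup>2)"
    proof (rule AE_I2)
      fix \<omega>
      have "D \<omega> \<le> \<nu> / 2 * (norm (d \<omega>))\<^sup>2"
        unfolding D_def d_def by (rule bregman_le_square[OF smooth])
      then show "norm (D \<omega>) \<le> norm (\<nu> / 2 * (norm (d \<omega>))\<^sup>2)"
        using D_nonneg[of \<omega>] by simp
    qed
  qed measurable
  have g2_bound: "integrable M (\<lambda>\<omega>. 2 * \<alpha> * D \<omega> + \<beta> * (S \<omega>)\<^sup>2)"
    and S2_bound: "integrable M (\<lambda>\<omega>. (1 - \<rho>) * (S \<omega>)\<^sup>2 + 2 * \<delta> * D \<omega>)"
    using D S by auto
  have g_le: "integrable M (\<lambda>\<omega>. (norm (g \<omega> - c))\<^sup>2)"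
    "expectation (\<lambda>\<omega>. (norm (g \<omega> - c))\<^sup>2) \<le> expectation (\<lambda>\<omega>. 2 * \<alpha> * D \<omega> + \<beta> * (S \<omega>)\<^sup>2)"
    by (rule integral_le_nn_cond_exp_bound[OF sub _ _ g2_bound];
        use gvar nonneg D_nonneg in \<open>simp add: D_def c_def\<close>)+
  show S'2: "integrable M (\<lambda>\<omega>. (S' \<omega>)\<^sup>2)"
    by (rule integral_le_nn_cond_exp_bound[OF sub _ _ S2_bound];
        use Svar nonneg D_nonneg in \<open>simp add: D_def\<close>)
  have S'_le: "expectation (\<lambda>\<omega>. (S' \<omega>)\<^sup>2) \<le> expectation (\<lambda>\<omega>. (1 - \<rho>) * (S \<omega>)\<^sup>2 + 2 * \<delta> * D \<omega>)"
    by (rule integral_le_nn_cond_exp_bound[OF sub _ _ S2_bound];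
        use Svar nonneg D_nonneg in \<open>simp add: D_def\<close>)
  have g2: "integrable M (\<lambda>\<omega>. (norm (g \<omega>))\<^sup>2)"
  proof (rule Bochner_Integration.integrable_bound)
    show "integrable M (\<lambda>\<omega>. 2 * (norm (g \<omega> - c))\<^sup>2 + 2 * (norm c)\<^sup>2)"
      using g_le(1) by simp
    have "(norm (g \<omega>))\<^sup>2 \<le> 2 * (norm (g \<omega> - c))\<^sup>2 + 2 * (norm c)\<^sup>2" for \<omega>
    proof -
      \<comment> \<open>The parallelogram law for \<open>g \<omega> - c\<close> and
        \<open>c\<close>, transferring the second moment from the centred gradient to
        \<open>g\<close>.\<close>
      have "2 * (norm (g \<omega> - c))\<^sup>2 + 2 * (norm c)\<^sup>2 = (norm (g \<omega>))\<^sup>2 + (norm (g \<omega> - 2 *\<^sub>R c))\<^sup>2"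
        unfolding power2_norm_eq_inner by (simp add: inner_diff inner_commute)
      then show ?thesis
        using zero_le_power2[of "norm (g \<omega> - 2 *\<^sub>R c)"] by linarith
    qed
    then show "AE \<omega> in M. norm ((norm (g \<omega>))\<^sup>2) \<le> norm (2 * (norm (g \<omega> - c))\<^sup>2 + 2 * (norm c)\<^sup>2)"
      by (intro AE_I2) simp
  qed measurable
  note inner = expectation_inner_cond_exp[OF sub ce dG g2 d2]
  have d1: "integrable M d"
  proof (rule Bochner_Integration.integrable_bound)
    show "integrable M (\<lambda>\<omega>. 1 + (norm (d \<omega>))\<^sup>2)"
      using d2 by simp
    have "norm (d \<omega>) \<le> 1 + (norm (d \<omega>))\<^sup>2" for \<omega>
      using sum_squares_bound[of 1 "norm (d \<omega>)"] norm_ge_zero[of "d \<omega>"]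
      unfolding one_power2 by linarith
    then show "AE \<omega> in M. norm (d \<omega>) \<le> norm (1 + (norm (d \<omega>))\<^sup>2)"
      by (intro AE_I2) simp
  qed measurable
  then have cd: "integrable M (\<lambda>\<omega>. c \<bullet> d \<omega>)"
    by simp
  have gd: "integrable M (\<lambda>\<omega>. (g \<omega> - c) \<bullet> d \<omega>)"
    unfolding inner_diff_left using inner cd by simp
  \<comment> \<open>Unbiasedness is used here: under the expectation against \<open>d\<close>, the
    gradient at \<open>x\<close> may be exchanged for \<open>g\<close>.\<close>
  have "expectation D \<le> expectation (\<lambda>\<omega>. gradient F (x \<omega>) \<bullet> d \<omega> - c \<bullet> d \<omega>)"
  proof (rule integral_mono[OF D])
    show "integrable M (\<lambda>\<omega>. gradient F (x \<omega>) \<bullet> d \<omega> - c \<bullet> d \<omega>)"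
      using inner cd by simp
    show "D \<omega> \<le> gradient F (x \<omega>) \<bullet> d \<omega> - c \<bullet> d \<omega>" for \<omega>
      using bregman_le_gradient_diff[OF conv smooth, of "x \<omega>" xs]
      by (simp add: D_def d_def c_def inner_diff_left)
  qed
  also have "\<dots> = expectation (\<lambda>\<omega>. (g \<omega> - c) \<bullet> d \<omega>)"
    unfolding inner_diff_left using inner cd by simp
  finally have D_le: "expectation D \<le> expectation (\<lambda>\<omega>. (g \<omega> - c) \<bullet> d \<omega>)" .
  define B where "B = (\<lambda>\<omega>. U \<omega> - 2 * \<gamma> * ((g \<omega> - c) \<bullet> d \<omega>) + \<gamma>\<^sup>2 * (norm (g \<omega> - c))\<^sup>2)"
  have B: "integrable M B"
    unfolding B_def using U gd g_le(1) by simp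
  have U'B: "U' \<omega> \<le> B \<omega>" if "\<omega> \<in> space M" for \<omega>
    using path[OF that] by (simp add: B_def c_def d_def)
  show U': "integrable M U'"
  proof (rule Bochner_Integration.integrable_bound[OF B U'M])
    show "AE \<omega> in M. norm (U' \<omega>) \<le> norm (B \<omega>)"
      using U'B U'_nonneg by (intro AE_I2) (force simp: abs_of_nonneg intro: order_trans[OF _ abs_ge_self])
  qed
  have "expectation U' \<le> expectation B"
    by (rule integral_mono[OF U' B U'B])
  also have "\<dots> = expectation U - 2 * \<gamma> * expectation (\<lambda>\<omega>. (g \<omega> - c) \<bullet> d \<omega>)
      + \<gamma>\<^sup>2 * expectation (\<lambda>\<omega>. (norm (g \<omega> - c))\<^sup>2)"
    unfolding B_def using U gd g_le(1) by simp
  also have "\<dots> \<le> expectation U - 2 * \<gamma> * expectation D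
      + \<gamma>\<^sup>2 * (2 * \<alpha> * expectation D + \<beta> * expectation (\<lambda>\<omega>. (S \<omega>)\<^sup>2))"
    using D_le g_le(2) D S nonneg by (intro add_mono diff_mono mult_left_mono) auto
  finally have 1: "expectation U' \<le> expectation U - 2 * \<gamma> * expectation D
      + \<gamma>\<^sup>2 * (2 * \<alpha> * expectation D + \<beta> * expectation (\<lambda>\<omega>. (S \<omega>)\<^sup>2))" .
  have "\<kappa> * \<gamma>\<^sup>2 * expectation (\<lambda>\<omega>. (S' \<omega>)\<^sup>2)
      \<le> \<kappa> * \<gamma>\<^sup>2 * ((1 - \<rho>) * expectation (\<lambda>\<omega>. (S \<omega>)\<^sup>2) + 2 * \<delta> * expectation D)"
    using S'_le D S nonneg by (intro mult_left_mono) auto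
  \<comment> \<open>Over both bounds \<open>expectation D\<close> collects the coefficient \<open>-
    2 * \<gamma> + 2 * \<gamma> * (\<gamma> * (\<alpha> + \<kappa> * \<delta>))\<close>, nonpositive
    by the step-size condition.\<close>
  moreover have "2 * \<gamma> * expectation D * (\<gamma> * (\<alpha> + \<kappa> * \<delta>)) \<le> 2 * \<gamma> * expectation D * 1"
    using \<gamma> nonneg D_nonneg by (intro mult_left_mono) (auto simp: integral_nonneg)
  moreover have "(1 - \<rho> + \<beta> / \<kappa>) * (\<kappa> * \<gamma>\<^sup>2 * e)
      = \<kappa> * \<gamma>\<^sup>2 * (1 - \<rho>) * e + \<gamma>\<^sup>2 * \<beta> * e" for e
    using nonneg by (simp add: field_simps)
  moreover have "\<gamma>\<^sup>2 * (2 * \<alpha> * e + \<beta> * f) + \<kappa> * \<gamma>\<^sup>2 * ((1 - \<rho>) * f + 2 * \<delta> * e)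
      = 2 * \<gamma> * e * (\<gamma> * (\<alpha> + \<kappa> * \<delta>)) + (\<kappa> * \<gamma>\<^sup>2 * (1 - \<rho>) * f + \<gamma>\<^sup>2 * \<beta> * f)" for e f
    by (simp add: algebra_simps power2_eq_square)
  ultimately show "expectation U' + \<kappa> * \<gamma>\<^sup>2 * expectation (\<lambda>\<omega>. (S' \<omega>)\<^sup>2)
      \<le> expectation U + (1 - \<rho> + \<beta> / \<kappa>) * (\<kappa> * \<gamma>\<^sup>2 * expectation (\<lambda>\<omega>. (S \<omega>)\<^sup>2))"
    using 1 by (smt (verit, ccfv_threshold))
qed

text \<open>The bounds on \<open>\<gamma>\<close> are cleared of denominators, so that they keep
  their meaning when \<open>\<alpha> + \<kappa> * \<delta>\<close> or \<open>onorm L\<close> is 0.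
  Integrability is asserted because the Bochner integral defaults to 0 otherwise. \<open>V 0\<close>
  is a function of the outcome but constant on the space, hence the quantified
  \<open>\<omega>\<^sub>0\<close>.\<close>

theorem theoremB2:
  fixes F :: "'a::euclidean_space \<Rightarrow> real"
    and R :: "'a \<Rightarrow> ereal"
    and H :: "'b::euclidean_space \<Rightarrow> ereal"
    and L :: "'a \<Rightarrow> 'b"
    and M :: "'w measure"
    and \<F> :: "nat \<Rightarrow> 'w measure"
    and g p x s :: "nat \<Rightarrow> 'w \<Rightarrow> 'a"
    and y :: "nat \<Rightarrow> 'w \<Rightarrow> 'b"
    and \<sigma> V :: "nat \<Rightarrow> 'w \<Rightarrow> real"
    and p0 xs ps :: 'a
    and y0 ys :: 'b
    and \<sigma>0 \<nu> \<gamma> \<tau> \<alpha> \<beta> \<delta> \<rho> \<kappa> \<mu>R \<mu>H \<eta> r :: real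
  assumes "linear L"
    and "0 < \<nu>" and "convex_on UNIV F" and "smooth_fun \<nu> F"
    and "pcl_fun R" and "pcl_fun H"
    and "primal_dual_solution F R H L xs ys"
    and "filtered_prob_space M \<F>"
    and "0 < \<gamma>" and "0 < \<tau>"
    and "ps = xs + \<gamma> *\<^sub>R adjoint L ys"
    and "\<And>\<omega>. \<omega> \<in> space M \<Longrightarrow>
           pddy_path \<gamma> \<tau> L R H p0 y0 (\<lambda>k. g k \<omega>)
             (\<lambda>k. p k \<omega>) (\<lambda>k. y k \<omega>) (\<lambda>k. x k \<omega>) (\<lambda>k. s k \<omega>)"
    and "\<And>\<omega>. \<omega> \<in> space M \<Longrightarrow> \<sigma> 0 \<omega> = \<sigma>0"
    and "stochastic_gradient_assumption M \<F> F xs \<alpha> \<beta> \<delta> \<rho> x g \<sigma>"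
    and "0 < \<mu>R" and "0 < \<mu>H"
    and "smooth_efun (1 / \<mu>H) H"
    and "strongly_convex_fun \<mu>R R"
    and "\<kappa> > \<beta> / \<rho>"
    and "\<gamma> * (\<alpha> + \<kappa> * \<delta>) \<le> 1"
    and "\<gamma> * \<tau> * (onorm L)\<^sup>2 < 1"
    and "\<gamma>\<^sup>2 * ((onorm L)\<^sup>2 * \<mu>R) \<le> \<mu>H"
    and "\<eta> = 2 * (\<mu>H - \<gamma>\<^sup>2 * (onorm L)\<^sup>2 * \<mu>R)"
    and "\<And>k \<omega>. V k \<omega> = (1 + \<gamma> * \<mu>R) * (norm (p k \<omega> - ps))\<^sup>2
             + (1 + \<tau> * \<eta>) * dual_norm_sq \<gamma> \<tau> L (y k \<omega> - ys)
             + \<kappa> * \<gamma>\<^sup>2 * (\<sigma> k \<omega>)\<^sup>2"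
    and "r = max (1 / (1 + \<gamma> * \<mu>R)) (max (1 - \<rho> + \<beta> / \<kappa>) (1 / (1 + \<tau> * \<eta>)))"
  shows "\<forall>k. integrable M (V k) \<and>
           (\<forall>\<omega>\<^sub>0\<in>space M. prob_space.expectation M (V k) \<le> r ^ k * V 0 \<omega>\<^sub>0)"
proof -
  note L = assms(1) and path = assms(12) and sga = assms(14)[unfolded stochastic_gradient_assumption_def]
  interpret prob_space M
    using assms(8) by (simp add: filtered_prob_space_def)
  have sub: "subalgebra M (\<F> k)" for k
    using assms(8) by (simp add: filtered_prob_space_def)
  have space_F: "space (\<F> k) = space M" for k
    using sub[of k] by (simp add: subalgebra_def)
  have F_mono: "subalgebra (\<F> (Suc k)) (\<F> k)" for k
    using assms(8) filtration.sets_F_mono[of "space M" \<F> k "Suc k"]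
    by (simp add: filtered_prob_space_def subalgebra_def space_F)
  have const: "0 \<le> \<alpha>" "0 \<le> \<beta>" "0 \<le> \<delta>" "0 < \<rho>" "\<rho> \<le> 1"
    and gF: "\<And>k. g k \<in> borel_measurable (\<F> k)" and \<sigma>F: "\<And>k. \<sigma> k \<in> borel_measurable (\<F> k)"
    and ce: "\<And>k. has_cond_exp M (\<F> k) (g (Suc k)) (\<lambda>\<omega>. gradient F (x k \<omega>))"
    using sga by auto
  have \<kappa>: "0 < \<kappa>"
    using assms(19) const by (meson divide_nonneg_pos le_less_trans)
  have \<eta>_nonneg: "0 \<le> \<eta>"
    using assms(22,23) by simp
  have r_ge: "1 / (1 + \<gamma> * \<mu>R) \<le> r" "1 - \<rho> + \<beta> / \<kappa> \<le> r" "1 / (1 + \<tau> * \<eta>) \<le> r"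
    using assms(25) by auto
  have weights_ge: "1 \<le> 1 + \<gamma> * \<mu>R" "1 \<le> 1 + \<tau> * \<eta>"
    using assms(9,10,15) \<eta>_nonneg by simp_all
  then have weights: "0 < 1 + \<gamma> * \<mu>R" "0 < 1 + \<tau> * \<eta>"
    by linarith+
  \<comment> \<open>In this form the rate turns the unweighted energy \<open>P k + N k\<close> into
    at most \<open>r * U k\<close>.\<close>
  have r_weights: "1 \<le> r * (1 + \<gamma> * \<mu>R)" "1 \<le> r * (1 + \<tau> * \<eta>)"
    using r_ge weights by (simp_all add: field_simps)
  have r_nonneg: "0 \<le> r"
    using r_ge(1) weights(1) by (smt (verit) divide_nonneg_nonneg)
  define P where "P = (\<lambda>k \<omega>. (norm (p k \<omega> - ps))\<^sup>2)"
  define N where "N = (\<lambda>k \<omega>. dual_norm_sq \<gamma> \<tau> L (y k \<omega> - ys))"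
  define U where "U = (\<lambda>k \<omega>. (1 + \<gamma> * \<mu>R) * P k \<omega> + (1 + \<tau> * \<eta>) * N k \<omega>)"
  have V: "V k = (\<lambda>\<omega>. U k \<omega> + \<kappa> * \<gamma>\<^sup>2 * (\<sigma> k \<omega>)\<^sup>2)" for k
    unfolding U_def P_def N_def using assms(24) by (intro ext) simp
  have P_nonneg: "0 \<le> P k \<omega>" for k \<omega>
    by (simp add: P_def)
  have N_nonneg: "0 \<le> N k \<omega>" for k \<omega>
    unfolding N_def by (rule dual_norm_sq_nonneg[OF assms(1,9,10,21)])
  have path_bounds: "(norm (x k \<omega> - xs))\<^sup>2 \<le> P k \<omega> + N k \<omega>"
    "U (Suc k) \<omega> \<le> P k \<omega> + N k \<omega> - 2 * \<gamma> * ((g (Suc k) \<omega> - gradient F xs) \<bullet> (x k \<omega> - xs))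
        + \<gamma>\<^sup>2 * (norm (g (Suc k) \<omega> - gradient F xs))\<^sup>2"
    if "\<omega> \<in> space M" for k \<omega>
    using pddy_path_step[OF assms(1,5,6,7,9,10,11) path[OF that] assms(15,16,17,18,21,23) \<eta>_nonneg, of k]
    by (simp_all add: U_def P_def N_def)
  have prox_R: "prox (\<lambda>v. ereal \<gamma> * R v) \<in> borel_measurable borel"
  proof -
    obtain u where u: "u \<in> subdifferential R xs"
      using assms(7) by (auto simp: primal_dual_solution_def)
    have "lsc_fun R" "proper_fun R" "convex_fun R"
      using assms(5) by (simp_all add: pcl_fun_def)
    then show ?thesis
      using u assms(9) by (intro prox_measurable closed_epigraph_lsc)
  qed
  have prox_H: "prox (\<lambda>v. ereal \<tau> * convex_conjugate H v) \<in> borel_measurable borel"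
  proof -
    obtain h where h: "H = (\<lambda>v. ereal (h v))" and h_smooth: "smooth_fun (1 / \<mu>H) h"
      using assms(17) by (auto simp: smooth_efun_def)
    have h_conv: "convex_on UNIV h"
      using assms(6) by (simp add: pcl_fun_def h convex_fun_ereal_iff)
    have h_diff: "h differentiable (at 0)"
      using h_smooth by (simp add: smooth_fun_def)
    have "L xs \<in> subdifferential (convex_conjugate H) ys"
      using assms(7) by (simp add: primal_dual_solution_def)
    then show ?thesis
      using assms(10) proper_convex_conjugate[OF h_conv h_diff] convex_conjugate_convex[of h]
      unfolding h by (intro prox_measurable closed_epigraph_conjugate)
  qed
  have adj: "adjoint L \<in> borel_measurable borel"
    by (intro borel_measurable_continuous_onI continuous_on_adjoint[OF L])
  have Lm: "L \<in> borel_measurable borel"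
    using L by (intro borel_measurable_continuous_onI) (simp add: linear_continuous_on linear_linear)
  note [measurable] = prox_R prox_H adj Lm dual_norm_sq_measurable[OF L]
  \<comment> \<open>The dual update and \<open>x k\<close> use only information up to time
    \<open>k\<close>, as pulling out \<open>x k\<close> requires; \<open>g (Suc k)\<close> first
    enters \<open>p (Suc k)\<close>. The recursion holds on the sample space, hence the congruence
    arguments.\<close>
  have next_measurable: "y (Suc k) \<in> borel_measurable (\<F> k)" "x k \<in> borel_measurable (\<F> k)"
    "p (Suc k) \<in> borel_measurable (\<F> (Suc k))"
    if [measurable]: "p k \<in> borel_measurable (\<F> k)" "y k \<in> borel_measurable (\<F> k)" for k
  proof -
    have "y (Suc k) \<omega> = prox (\<lambda>v. ereal \<tau> * convex_conjugate H v)
        (y k \<omega> + \<tau> *\<^sub>R L (p k \<omega> - \<gamma> *\<^sub>R adjoint L (y k \<omega>)))" if "\<omega> \<in> space (\<F> k)" for \<omega>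
      using path[of \<omega>] that by (simp add: pddy_path_def space_F)
    then show y [measurable]: "y (Suc k) \<in> borel_measurable (\<F> k)"
      by (subst measurable_cong) (assumption, measurable)
    have "x k \<omega> = p k \<omega> - \<gamma> *\<^sub>R adjoint L (y (Suc k) \<omega>)" if "\<omega> \<in> space (\<F> k)" for \<omega>
      using path[of \<omega>] that by (simp add: pddy_path_def space_F)
    then show x: "x k \<in> borel_measurable (\<F> k)"
      by (subst measurable_cong) (assumption, measurable)
    have [measurable]: "x k \<in> borel_measurable (\<F> (Suc k))" "p k \<in> borel_measurable (\<F> (Suc k))"
      using measurable_from_subalg[OF F_mono x] measurable_from_subalg[OF F_mono that(1)] by auto
    have [measurable]: "g (Suc k) \<in> borel_measurable (\<F> (Suc k))"
      by (rule gF)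
    have "p (Suc k) \<omega> = p k \<omega> + prox (\<lambda>v. ereal \<gamma> * R v) (2 *\<^sub>R x k \<omega> - p k \<omega> - \<gamma> *\<^sub>R g (Suc k) \<omega>) - x k \<omega>"
      if "\<omega> \<in> space (\<F> (Suc k))" for \<omega>
      using path[of \<omega>] that by (simp add: pddy_path_def space_F)
    then show "p (Suc k) \<in> borel_measurable (\<F> (Suc k))"
      by (subst measurable_cong) (assumption, measurable)
  qed
  \<comment> \<open>The induction invariant: the expectation bound for one step presupposes
    adaptedness and finite second moments, and these are in turn obtained from the previous
    step.\<close>
  define regular where "regular = (\<lambda>k. p k \<in> borel_measurable (\<F> k) \<and> y k \<in> borel_measurable (\<F> k)
    \<and> integrable M (P k) \<and> integrable M (N k) \<and> integrable M (\<lambda>\<omega>. (\<sigma> k \<omega>)\<^sup>2))"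
  have regular_0: "regular 0"
  proof -
    have p0: "p 0 \<omega> = p0" and y0: "y 0 \<omega> = y0" if "\<omega> \<in> space M" for \<omega>
      using path[OF that] by (simp_all add: pddy_path_def)
    have "p 0 \<in> borel_measurable (\<F> 0)" "y 0 \<in> borel_measurable (\<F> 0)"
      using p0 y0 measurable_cong[of "\<F> 0" "p 0" "\<lambda>_. p0" borel] measurable_cong[of "\<F> 0" "y 0" "\<lambda>_. y0" borel]
      by (simp_all add: space_F)
    moreover have "integrable M (P 0)" "integrable M (N 0)" "integrable M (\<lambda>\<omega>. (\<sigma> 0 \<omega>)\<^sup>2)"
      unfolding P_def N_def using p0 y0 assms(13)
      by (auto cong: Bochner_Integration.integrable_cong)
    ultimately show ?thesis
      by (simp add: regular_def)
  qed
  have regular_step: "regular (Suc k) \<and> expectation (V (Suc k)) \<le> r * expectation (V k)" if "regular k" for k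
  proof -
    have pk: "p k \<in> borel_measurable (\<F> k)" and yk: "y k \<in> borel_measurable (\<F> k)"
      and Pk: "integrable M (P k)" and Nk: "integrable M (N k)"
      and \<sigma>k: "integrable M (\<lambda>\<omega>. (\<sigma> k \<omega>)\<^sup>2)"
      using that by (auto simp: regular_def)
    note next_k = next_measurable[OF pk yk]
    have y_next: "y (Suc k) \<in> borel_measurable (\<F> (Suc k))"
      by (rule measurable_from_subalg[OF F_mono next_k(1)])
    have [measurable]: "p (Suc k) \<in> borel_measurable M" "y (Suc k) \<in> borel_measurable M"
      "x k \<in> borel_measurable M"
      using next_k y_next sub by (auto intro: measurable_from_subalg)
    have PM [measurable]: "P (Suc k) \<in> borel_measurable M" and NM [measurable]: "N (Suc k) \<in> borel_measurable M"
      unfolding P_def N_def by measurable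
    have UM: "U (Suc k) \<in> borel_measurable M"
      unfolding U_def by measurable
    have x2: "integrable M (\<lambda>\<omega>. (norm (x k \<omega> - xs))\<^sup>2)"
    proof (rule Bochner_Integration.integrable_bound)
      show "integrable M (\<lambda>\<omega>. P k \<omega> + N k \<omega>)"
        using Pk Nk by simp
      show "AE \<omega> in M. norm ((norm (x k \<omega> - xs))\<^sup>2) \<le> norm (P k \<omega> + N k \<omega>)"
        using path_bounds(1) P_nonneg N_nonneg by (intro AE_I2) simp
    qed measurable
    have PN_le: "P j \<omega> + N j \<omega> \<le> U j \<omega>" for j \<omega>
      using mult_right_mono[OF weights_ge(1) P_nonneg[of j \<omega>]] mult_right_mono[OF weights_ge(2) N_nonneg[of j \<omega>]]
      by (simp add: U_def)
    have U_nonneg: "0 \<le> U j \<omega>" for j \<omega>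
      using P_nonneg[of j \<omega>] N_nonneg[of j \<omega>] PN_le[of j \<omega>] by linarith
    have PN: "integrable M (\<lambda>\<omega>. P k \<omega> + N k \<omega>)"
      using Pk Nk by simp
    have gM: "g (Suc k) \<in> borel_measurable M" and \<sigma>M: "\<sigma> (Suc k) \<in> borel_measurable M"
      using gF \<sigma>F sub by (auto intro: measurable_from_subalg)
    have gvar: "AE \<omega> in M. nn_cond_exp M (\<F> k) (\<lambda>\<omega>. ennreal ((norm (g (Suc k) \<omega> - gradient F xs))\<^sup>2)) \<omega>
        \<le> ennreal (2 * \<alpha> * bregman F (x k \<omega>) xs + \<beta> * (\<sigma> k \<omega>)\<^sup>2)"
      and \<sigma>var: "AE \<omega> in M. nn_cond_exp M (\<F> k) (\<lambda>\<omega>. ennreal ((\<sigma> (Suc k) \<omega>)\<^sup>2)) \<omega>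
        \<le> ennreal ((1 - \<rho>) * (\<sigma> k \<omega>)\<^sup>2 + 2 * \<delta> * bregman F (x k \<omega>) xs)"
      using sga by blast+
    \<comment> \<open>The weights \<open>1 + \<gamma> * \<mu>R\<close> and
      \<open>1 + \<tau> * \<eta>\<close> appear only in the energy after the step; this asymmetry is
      the source of the contraction.\<close>
    note descent = variance_reduced_step[OF sub assms(3,4) const(1,2,3,5) \<kappa> assms(9,20) next_k(2) gM \<sigma>M UM
        PN \<sigma>k x2 U_nonneg path_bounds(2) ce gvar \<sigma>var]
    have U_int: "integrable M (U (Suc k))" and \<sigma>_int: "integrable M (\<lambda>\<omega>. (\<sigma> (Suc k) \<omega>)\<^sup>2)"
      by (rule descent; assumption)+
    have P_int: "integrable M (P (Suc k))"
    proof (rule Bochner_Integration.integrable_bound[OF U_int PM])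
      have "P (Suc k) \<omega> \<le> U (Suc k) \<omega>" for \<omega>
        using PN_le[of "Suc k" \<omega>] N_nonneg[of "Suc k" \<omega>] by linarith
      then show "AE \<omega> in M. norm (P (Suc k) \<omega>) \<le> norm (U (Suc k) \<omega>)"
        using P_nonneg U_nonneg by (intro AE_I2) simp
    qed
    have N_int: "integrable M (N (Suc k))"
    proof (rule Bochner_Integration.integrable_bound[OF U_int NM])
      have "N (Suc k) \<omega> \<le> U (Suc k) \<omega>" for \<omega>
        using PN_le[of "Suc k" \<omega>] P_nonneg[of "Suc k" \<omega>] by linarith
      then show "AE \<omega> in M. norm (N (Suc k) \<omega>) \<le> norm (U (Suc k) \<omega>)"
        using N_nonneg U_nonneg by (intro AE_I2) simp
    qed
    have Uk_int: "integrable M (U k)"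
      unfolding U_def using Pk Nk by simp
    have "expectation (V (Suc k)) = expectation (U (Suc k)) + \<kappa> * \<gamma>\<^sup>2 * expectation (\<lambda>\<omega>. (\<sigma> (Suc k) \<omega>)\<^sup>2)"
      unfolding V using U_int \<sigma>_int by simp
    also have "\<dots> \<le> expectation (\<lambda>\<omega>. P k \<omega> + N k \<omega>)
        + (1 - \<rho> + \<beta> / \<kappa>) * (\<kappa> * \<gamma>\<^sup>2 * expectation (\<lambda>\<omega>. (\<sigma> k \<omega>)\<^sup>2))"
      by (rule descent(3))
    also have "\<dots> \<le> r * expectation (U k) + r * (\<kappa> * \<gamma>\<^sup>2 * expectation (\<lambda>\<omega>. (\<sigma> k \<omega>)\<^sup>2))"
    proof (rule add_mono)
      have "P k \<omega> + N k \<omega> \<le> r * U k \<omega>" for \<omega>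
        using mult_right_mono[OF r_weights(1) P_nonneg[of k \<omega>]] mult_right_mono[OF r_weights(2) N_nonneg[of k \<omega>]]
        by (simp add: U_def algebra_simps)
      then have "expectation (\<lambda>\<omega>. P k \<omega> + N k \<omega>) \<le> expectation (\<lambda>\<omega>. r * U k \<omega>)"
        using PN Uk_int by (intro integral_mono) auto
      then show "expectation (\<lambda>\<omega>. P k \<omega> + N k \<omega>) \<le> r * expectation (U k)"
        by simp
      show "(1 - \<rho> + \<beta> / \<kappa>) * (\<kappa> * \<gamma>\<^sup>2 * expectation (\<lambda>\<omega>. (\<sigma> k \<omega>)\<^sup>2))
          \<le> r * (\<kappa> * \<gamma>\<^sup>2 * expectation (\<lambda>\<omega>. (\<sigma> k \<omega>)\<^sup>2))"
        using \<kappa> by (intro mult_right_mono r_ge(2)) (simp add: integral_nonneg)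
    qed
    also have "\<dots> = r * expectation (V k)"
      unfolding V using Uk_int \<sigma>k by (simp add: distrib_left)
    finally have "expectation (V (Suc k)) \<le> r * expectation (V k)" .
    then show ?thesis
      using next_k(3) y_next P_int N_int \<sigma>_int by (simp add: regular_def)
  qed
  have regular: "regular k" for k
    by (induction k) (use regular_0 regular_step in auto)
  have V_int: "integrable M (V k)" for k
    unfolding V U_def using regular[of k] by (simp add: regular_def)
  have rate: "expectation (V k) \<le> r ^ k * expectation (V 0)" for k
  proof (induction k)
    case (Suc k)
    have "expectation (V (Suc k)) \<le> r * expectation (V k)"
      using regular_step[OF regular] by blast
    also have "\<dots> \<le> r * (r ^ k * expectation (V 0))"
      using Suc r_nonneg by (rule mult_left_mono)
    finally show ?case
      by simp
  qed simp
  have "expectation (V 0) = V 0 \<omega>\<^sub>0" if "\<omega>\<^sub>0 \<in> space M" for \<omega>\<^sub>0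
  proof -
    \<comment> \<open>The initial data are deterministic, so the expectation of \<open>V 0\<close>
      is its common value.\<close>
    have "V 0 \<omega> = V 0 \<omega>\<^sub>0" if "\<omega> \<in> space M" for \<omega>
      using path[OF that] path[OF \<open>\<omega>\<^sub>0 \<in> space M\<close>] assms(13)[OF that] assms(13)[OF \<open>\<omega>\<^sub>0 \<in> space M\<close>]
      by (simp add: assms(24) pddy_path_def)
    then have "expectation (V 0) = expectation (\<lambda>_. V 0 \<omega>\<^sub>0)"
      by (intro Bochner_Integration.integral_cong) auto
    then show ?thesis
      by (simp add: prob_space)
  qed
  then show ?thesis
    using V_int rate by auto
qed

end
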